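(* Let $D$ be an integral domain and let $\star$ be a semistar operation on $D$. The following are equivalent: (i) $D$ is a P$\star$MD. (ii) $D$ is a $\star$-extracoherent $\star$-domain. (ii$_f$) $D$ is a $\star_f$-extracoherent $\star$-domain. ($\widetilde{\mathrm{ii}}$) $D$ is a $\widetilde{\star}$-extracoherent $\star$-domain. (iii$_f$) $D$ is a truly $\star_f$-coherent $\star$-domain. ($\widetilde{\mathrm{iii}}$) $D$ is a truly $\widetilde{\star}$-coherent $\star$-domain. ($\widetilde{\mathrm{iv}}$) $D$ is a $\widetilde{\star}$-coherent $\star$-domain. (v$_f$) $D$ is a $\star_f$-quasi-coherent $\star$-domain (or, equivalently, a $\star_f$-domain). ($\widetilde{\mathrm{v}}$) $D$ is a $\widetilde{\star}$-quasi-coherent $\star$-domain (or, equivalently, a $\widetilde{\star}$-domain). In particular, a quasi-coherent $\star$-domain is a P$\star$MD.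
   Context: Let $D$ be an integral domain with quotient field $K$. $\overline{\boldsymbol F}(D)$ is the set of nonzero $D$-submodules of $K$, and $\boldsymbol f(D)$ the set of nonzero finitely generated $D$-submodules of $K$. For $D$-submodules $E,F$ of $K$, $(E:F)=\{x\in K: xF\subseteq E\}$ and $F^{-1}=(D:F)$. A semistar operation on $D$ is a map $\star:\overline{\boldsymbol F}(D)\to\overline{\boldsymbol F}(D)$, $E\mapsto E^\star$, such that for all $0\ne x\in K$ and $E,F\in\overline{\boldsymbol F}(D)$: $(xE)^\star=xE^\star$; $E\subseteq F$ implies $E^\star\subseteq F^\star$; $E\subseteq E^\star$ and $(E^\star)^\star=E^\star$. The finite type operation $\star_f$ is $E^{\star_f}=\bigcup\{F^\star: F\in\boldsymbol f(D),\ F\subseteq E\}$; it is again a semistar operation. A nonzero ideal $I$ of $D$ is a quasi-$\star$-ideal if $I^\star\cap D=I$; $\mathcal M(\star_f)$ is the set of ideals maximal among the proper quasi-$\star_f$-ideals (these are prime). The semistar operation $\widetilde\star$ is $E^{\widetilde\star}=\bigcap\{ED_M: M\in\mathcal M(\star_f)\}$ (an empty intersection being $K$). For a semistar operation $*$ on $D$ (applied with $*=\star,\star_f,\widetilde\star$): - $D$ is a $*$-domain if $(II^{-1})^*=D^*$ for each $I\in\boldsymbol f(D)$. - $D$ is a P$*$MD (Prüfer $*$-multiplication domain) if $(II^{-1})^{*_f}=D^*$ for each nonzero finitely generated ideal $I$ of $D$. - $D$ is $*$-extracoherent if for all $E,F\in\boldsymbol f(D)$ with $E\cap F\neq 0$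 there is $J\in\boldsymbol f(D)$ with $J\subseteq E\cap F$ and $J^*=E^*\cap F^*$. - $D$ is $*$-coherent if for all $E,F\in\boldsymbol f(D)$ with $E\cap F\ne0$ there is $J\in\boldsymbol f(D)$ with $J^*=E^*\cap F^*$. - $D$ is truly $*$-coherent if for all $E,F\in\boldsymbol f(D)$ with $E\cap F\ne 0$ there is $J\in\boldsymbol f(D)$ with $J^*=(E\cap F)^*$. - $D$ is $*$-quasi-coherent if for each $F\in\boldsymbol f(D)$ there is $G\in\boldsymbol f(D)$ with $(D:F)^*=G^*$. "Quasi-coherent" means $d$-quasi-coherent, where $d$ is the identity operation (i.e. $(D:F)$ is finitely generated for each $F\in\boldsymbol f(D)$). *)

theory Defs
  imports Main "HOL-Computational_Algebra.Polynomial_Factorial"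
begin

text \<open>
  The integral domain \<open>D\<close> is an arbitrary type \<open>'a\<close> of class \<open>idom\<close>, and its quotient field \<open>K\<close> is
  \<open>'a fract\<close>, viewed as a \<open>D\<close>-module. All ideals and submodules are subsets of \<open>K\<close>; in particular
  \<open>D\<close> itself is identified with its image \<open>D_ring\<close> in \<open>K\<close>.
\<close>

definition D_smult :: "'a::idom \<Rightarrow> 'a fract \<Rightarrow> 'a fract" where
  "D_smult d x = to_fract d * x"

interpretation Dmod: module "D_smult :: 'a::idom \<Rightarrow> 'a fract \<Rightarrow> 'a fract"
  by unfold_locales (simp_all add: D_smult_def algebra_simps)

definition D_ring :: "'a::idom fract set" where
  "D_ring = range to_fract"

definition nonzero_submodules :: "'a::idom fract set set" where
  "nonzero_submodules = {E. Dmod.subspace E \<and> E \<noteq> {0}}"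

definition fg_submodules :: "'a::idom fract set set" where
  "fg_submodules = {E. (\<exists>S. finite S \<and> E = Dmod.span S) \<and> E \<noteq> {0}}"

definition smult_set :: "'a::idom fract \<Rightarrow> 'a fract set \<Rightarrow> 'a fract set" where
  "smult_set x E = (\<lambda>y. x * y) ` E"

definition submodule_prod :: "'a::idom fract set \<Rightarrow> 'a fract set \<Rightarrow> 'a fract set" where
  "submodule_prod E F = Dmod.span {x * y | x y. x \<in> E \<and> y \<in> F}"

definition colon :: "'a::idom fract set \<Rightarrow> 'a fract set \<Rightarrow> 'a fract set" where
  "colon E F = {x. smult_set x F \<subseteq> E}"

definition inv_submodule :: "'a::idom fract set \<Rightarrow> 'a fract set" where
  "inv_submodule F = colon D_ring F"

definition nonzero_ideal :: "'a::idom fract set \<Rightarrow> bool" where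
  "nonzero_ideal I \<longleftrightarrow> I \<in> nonzero_submodules \<and> I \<subseteq> D_ring"

text \<open>
  Operations are total functions on subsets of \<open>K\<close>; only their values on nonzero submodules are
  constrained, and only those values matter below.
\<close>

definition semistar :: "('a::idom fract set \<Rightarrow> 'a fract set) \<Rightarrow> bool" where
  "semistar s \<longleftrightarrow>
     (\<forall>E\<in>nonzero_submodules. s E \<in> nonzero_submodules) \<and>
     (\<forall>x. \<forall>E\<in>nonzero_submodules. x \<noteq> 0 \<longrightarrow> s (smult_set x E) = smult_set x (s E)) \<and>
     (\<forall>E\<in>nonzero_submodules. \<forall>F\<in>nonzero_submodules. E \<subseteq> F \<longrightarrow> s E \<subseteq> s F) \<and>
     (\<forall>E\<in>nonzero_submodules. E \<subseteq> s E \<and> s (s E) = s E)"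

definition star_f :: "('a::idom fract set \<Rightarrow> 'a fract set) \<Rightarrow> 'a fract set \<Rightarrow> 'a fract set" where
  "star_f s E = \<Union> {s F | F. F \<in> fg_submodules \<and> F \<subseteq> E}"

definition quasi_star_ideal :: "('a::idom fract set \<Rightarrow> 'a fract set) \<Rightarrow> 'a fract set \<Rightarrow> bool" where
  "quasi_star_ideal s I \<longleftrightarrow> nonzero_ideal I \<and> s I \<inter> D_ring = I"

definition quasi_star_max_ideals ::
    "('a::idom fract set \<Rightarrow> 'a fract set) \<Rightarrow> 'a fract set set" where
  "quasi_star_max_ideals s =
     {M. quasi_star_ideal s M \<and> M \<noteq> D_ring \<and>
         (\<forall>I. quasi_star_ideal s I \<and> I \<noteq> D_ring \<and> M \<subseteq> I \<longrightarrow> I = M)}"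

text \<open>The localization \<open>D\<^sub>M\<close>, a subring of \<open>K\<close> when \<open>M\<close> is a prime ideal.\<close>

definition D_localization :: "'a::idom fract set \<Rightarrow> 'a fract set" where
  "D_localization M = {a / t | a t. a \<in> D_ring \<and> t \<in> D_ring - M}"

text \<open>The intersection of the empty family is \<open>UNIV\<close>, i.e. \<open>K\<close>.\<close>

definition star_tilde :: "('a::idom fract set \<Rightarrow> 'a fract set) \<Rightarrow> 'a fract set \<Rightarrow> 'a fract set" where
  "star_tilde s E =
     \<Inter> {submodule_prod E (D_localization M) | M. M \<in> quasi_star_max_ideals (star_f s)}"

definition star_domain :: "('a::idom fract set \<Rightarrow> 'a fract set) \<Rightarrow> bool" where
  "star_domain s \<longleftrightarrow>
     (\<forall>I\<in>fg_submodules. s (submodule_prod I (inv_submodule I)) = s D_ring)"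

definition PsMD :: "('a::idom fract set \<Rightarrow> 'a fract set) \<Rightarrow> bool" where
  "PsMD s \<longleftrightarrow>
     (\<forall>I. nonzero_ideal I \<and> I \<in> fg_submodules \<longrightarrow>
        star_f s (submodule_prod I (inv_submodule I)) = s D_ring)"

definition extracoherent :: "('a::idom fract set \<Rightarrow> 'a fract set) \<Rightarrow> bool" where
  "extracoherent s \<longleftrightarrow>
     (\<forall>E\<in>fg_submodules. \<forall>F\<in>fg_submodules. E \<inter> F \<noteq> {0} \<longrightarrow>
        (\<exists>J\<in>fg_submodules. J \<subseteq> E \<inter> F \<and> s J = s E \<inter> s F))"

definition coherent :: "('a::idom fract set \<Rightarrow> 'a fract set) \<Rightarrow> bool" where
  "coherent s \<longleftrightarrow>
     (\<forall>E\<in>fg_submodules. \<forall>F\<in>fg_submodules. E \<inter> F \<noteq> {0} \<longrightarrow>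
        (\<exists>J\<in>fg_submodules. s J = s E \<inter> s F))"

definition truly_coherent :: "('a::idom fract set \<Rightarrow> 'a fract set) \<Rightarrow> bool" where
  "truly_coherent s \<longleftrightarrow>
     (\<forall>E\<in>fg_submodules. \<forall>F\<in>fg_submodules. E \<inter> F \<noteq> {0} \<longrightarrow>
        (\<exists>J\<in>fg_submodules. s J = s (E \<inter> F)))"

definition quasi_coherent :: "('a::idom fract set \<Rightarrow> 'a fract set) \<Rightarrow> bool" where
  "quasi_coherent s \<longleftrightarrow>
     (\<forall>F\<in>fg_submodules. \<exists>G\<in>fg_submodules. s (inv_submodule F) = s G)"

end

theory Submission
  imports Defs "HOL-Library.Set_Algebras"
begin

text \<open>
  Write \<open>E\<^sup>t\<close> for the operation \<open>star_tilde s\<close>. Call a finitely generated \<open>I\<close> invertible if some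
  finitely generated \<open>G \<subseteq> I\<inverse>\<close> satisfies \<open>1 \<in> (I G)\<^sup>\<star>\<close>. By Zorn's lemma and the primality of the
  maximal quasi-\<open>\<star>\<^sub>f\<close>-ideals, \<open>x \<in> E\<^sup>t\<close> iff \<open>x T \<subseteq> E\<close> for some finitely generated \<open>T \<subseteq> D\<close> with
  \<open>1 \<in> T\<^sup>\<star>\<close>. Hence the multiplication property and the domain conditions for \<open>\<star>\<^sub>f\<close> and \<open>t\<close> all mean
  that every finitely generated \<open>I\<close> is invertible. If \<open>E + F\<close> is invertible with witness \<open>G\<close>, then
  \<open>E F G\<close> approximates \<open>E \<inter> F\<close>, which yields all coherence properties. Conversely, in a
  \<open>\<star>\<close>-domain each intersection condition, applied to \<open>(a, b)\<inverse> = a\<inverse> D \<inter> b\<inverse> D\<close>, makes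
  two-generated submodules invertible, and Pruefer's identity
  \<open>(A + B) (B + C) (C + A) = (A + B + C) (A B + B C + C A)\<close> extends this to any number of
  generators; the quasi-coherence conditions approximate \<open>I\<inverse>\<close> directly.
\<close>

subsection \<open>Submodules of the quotient field\<close>

lemma one_in_D_ring [simp]: "1 \<in> (D_ring :: 'a::idom fract set)"
  unfolding D_ring_def by (metis rangeI to_fract_1)

lemma zero_in_D_ring [simp]: "0 \<in> (D_ring :: 'a::idom fract set)"
  unfolding D_ring_def by (metis rangeI to_fract_0)

lemma D_ring_add: "x \<in> D_ring \<Longrightarrow> y \<in> D_ring \<Longrightarrow> x + y \<in> (D_ring :: 'a::idom fract set)"
  unfolding D_ring_def by (auto simp flip: to_fract_add)

lemma D_ring_mult: "x \<in> D_ring \<Longrightarrow> y \<in> D_ring \<Longrightarrow> x * y \<in> (D_ring :: 'a::idom fract set)"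
  unfolding D_ring_def by (auto simp flip: to_fract_mult)

text \<open>Trades scalars of type \<open>'a\<close> for elements of \<open>D_ring\<close>, so that
  later arguments stay inside the quotient field.\<close>

lemma subspace_iff:
  "Dmod.subspace E \<longleftrightarrow>
     0 \<in> E \<and> (\<forall>x\<in>E. \<forall>y\<in>E. x + y \<in> E) \<and> (\<forall>d\<in>D_ring. \<forall>x\<in>E. d * x \<in> E)"
  by (auto simp: Dmod.subspace_def D_smult_def D_ring_def)

lemma subspace_mult: "Dmod.subspace E \<Longrightarrow> d \<in> D_ring \<Longrightarrow> x \<in> E \<Longrightarrow> d * x \<in> E"
  by (auto simp: subspace_iff)

lemma subspace_D_ring: "Dmod.subspace (D_ring :: 'a::idom fract set)"
  by (auto simp: subspace_iff D_ring_add D_ring_mult)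

text \<open>Serves to pass from generators to spans in product conditions: with the factors in
  \<open>T\<close> fixed, the other factor ranges over a submodule.\<close>

lemma subspace_residual: "Dmod.subspace V \<Longrightarrow> Dmod.subspace {x. \<forall>y\<in>T. x * y \<in> V}"
  by (auto simp: subspace_iff algebra_simps)

lemma D_ring_eq_span: "D_ring = Dmod.span {1 :: 'a::idom fract}"
  by (auto simp: Dmod.span_singleton D_smult_def D_ring_def)

section \<open>Denominators and products of spans\<close>

lemma ex_denominator:
  fixes x :: "'a::idom fract"
  obtains d where "d \<in> D_ring" "d \<noteq> 0" "d * x \<in> D_ring"
proof (cases x rule: Fract_cases)
  case (Fract a b)
  then have "to_fract b * x = to_fract a"
    by (simp add: Fract_conv_to_fract)
  then show thesis
    using that[of "to_fract b"] Fract(2) by (auto simp: D_ring_def)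
qed

lemma ex_common_denominator:
  fixes S :: "'a::idom fract set"
  assumes "finite S"
  obtains d where "d \<in> D_ring" "d \<noteq> 0" "{d} * S \<subseteq> D_ring"
  using assms
proof (induction S arbitrary: thesis rule: finite_induct)
  case empty
  then show ?case
    using one_in_D_ring by (metis empty_iff set_times_elim subsetI zero_neq_one)
next
  case (insert x S)
  obtain d where d: "d \<in> D_ring" "d \<noteq> 0" "{d} * S \<subseteq> D_ring"
    using insert.IH by blast
  obtain c where c: "c \<in> D_ring" "c \<noteq> 0" "c * x \<in> D_ring"
    by (rule ex_denominator)
  have "{c * d} * insert x S \<subseteq> D_ring"
  proof
    fix z assume "z \<in> {c * d} * insert x S"
    then obtain y where "y \<in> insert x S" "z = d * (c * x) \<or> y \<in> S \<and> z = c * (d * y)"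
      by (auto simp: set_times_def algebra_simps)
    then show "z \<in> D_ring"
      using c d by (auto intro: D_ring_mult)
  qed
  then show ?case
    using c d insert.prems by (meson D_ring_mult mult_eq_0_iff)
qed

text \<open>Two passes of \<open>subspace_residual\<close>, enlarging first the left and then the
  right factor from generators to the span.\<close>

lemma span_times_span_subset:
  assumes "Dmod.subspace V" "S * T \<subseteq> V"
  shows "Dmod.span S * Dmod.span T \<subseteq> V"
proof -
  have "Dmod.span S \<subseteq> {x. \<forall>y\<in>T. x * y \<in> V}"
    using assms by (intro Dmod.span_minimal subspace_residual) (auto intro: set_times_intro)
  then have "T \<subseteq> {y. \<forall>x\<in>Dmod.span S. y * x \<in> V}"
    by (fastforce simp: mult.commute)
  then have "Dmod.span T \<subseteq> {y. \<forall>x\<in>Dmod.span S. y * x \<in> V}"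
    using assms(1) by (intro Dmod.span_minimal subspace_residual)
  then have "y * x \<in> V" if "x \<in> Dmod.span S" "y \<in> Dmod.span T" for x y
    using that by blast
  then show ?thesis
    by (metis mult.commute set_times_elim subsetI)
qed

lemma submodule_prod_eq: "submodule_prod E F = Dmod.span (E * F)"
  unfolding submodule_prod_def set_times_def by (rule arg_cong[of _ _ Dmod.span]) auto

lemma submodule_prod_span [simp]:
  "submodule_prod (Dmod.span S) (Dmod.span T) = Dmod.span (S * T)"
proof
  show "submodule_prod (Dmod.span S) (Dmod.span T) \<subseteq> Dmod.span (S * T)"
    unfolding submodule_prod_eq
    by (intro Dmod.span_minimal span_times_span_subset Dmod.subspace_span Dmod.span_superset)
  show "Dmod.span (S * T) \<subseteq> submodule_prod (Dmod.span S) (Dmod.span T)"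
    unfolding submodule_prod_eq
    by (intro Dmod.span_mono set_times_mono2 Dmod.span_superset)
qed

text \<open>Together with \<open>finite_subset_of_span\<close> this extracts finitely many elements
  of an inverse module from a finite part of a product module.\<close>

lemma finite_subset_of_times:
  assumes "finite F" "F \<subseteq> S * X"
  obtains T where "finite T" "T \<subseteq> X" "F \<subseteq> S * T"
proof -
  have "\<forall>u\<in>F. \<exists>t\<in>X. \<exists>y\<in>S. u = y * t"
    using assms(2) unfolding set_times_def by blast
  then obtain t where "\<forall>u\<in>F. t u \<in> X \<and> (\<exists>y\<in>S. u = y * t u)"
    by metis
  then show thesis
    using assms(1) by (intro that[of "t ` F"]) (fastforce simp: set_times_def)+
qed

lemma finite_subset_of_span:
  assumes "finite U" "U \<subseteq> Dmod.span X"
  obtains F where "finite F" "F \<subseteq> X" "U \<subseteq> Dmod.span F"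
  using assms
proof (induction U arbitrary: thesis rule: finite_induct)
  case empty
  then show ?case by blast
next
  case (insert x U)
  obtain F where F: "finite F" "F \<subseteq> X" "U \<subseteq> Dmod.span F"
    using insert by blast
  obtain G r where G: "finite G" "G \<subseteq> X" "x = (\<Sum>a\<in>G. D_smult (r a) a)"
    using insert.prems(2) by (auto simp: Dmod.span_explicit)
  have "x \<in> Dmod.span G"
    unfolding G(3) by (intro Dmod.span_sum Dmod.span_scale Dmod.span_base)
  then have "insert x U \<subseteq> Dmod.span (F \<union> G)"
    using F(3) Dmod.span_mono[of F "F \<union> G"] Dmod.span_mono[of G "F \<union> G"] by auto
  then show ?case
    using F G insert.prems(1)[of "F \<union> G"] by auto
qed

section \<open>Inverse modules and nonzero modules in terms of generators\<close>

lemma inv_submodule_eq: "inv_submodule E = {x. \<forall>y\<in>E. x * y \<in> D_ring}"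
  unfolding inv_submodule_def colon_def smult_set_def by blast

lemma inv_submodule_span: "inv_submodule (Dmod.span S) = {x. \<forall>y\<in>S. x * y \<in> D_ring}"
proof
  show "inv_submodule (Dmod.span S) \<subseteq> {x. \<forall>y\<in>S. x * y \<in> D_ring}"
    using Dmod.span_superset[of S] unfolding inv_submodule_eq by blast
  show "{x. \<forall>y\<in>S. x * y \<in> D_ring} \<subseteq> inv_submodule (Dmod.span S)"
  proof
    fix x assume "x \<in> {x. \<forall>y\<in>S. x * y \<in> D_ring}"
    then have "S \<subseteq> {y. \<forall>z\<in>{x}. y * z \<in> D_ring}"
      by (simp add: mult.commute subset_iff)
    then have "Dmod.span S \<subseteq> {y. \<forall>z\<in>{x}. y * z \<in> D_ring}"
      by (intro Dmod.span_minimal subspace_residual subspace_D_ring)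
    then show "x \<in> inv_submodule (Dmod.span S)"
      unfolding inv_submodule_eq by (simp add: mult.commute subset_iff)
  qed
qed

lemma times_inv_submodule_subset: "S * inv_submodule (Dmod.span S) \<subseteq> D_ring"
proof -
  have "y * x \<in> D_ring" if "y \<in> S" "x \<in> inv_submodule (Dmod.span S)" for x y
    using that unfolding inv_submodule_span by (simp add: mult.commute[of y x])
  then show ?thesis
    by (auto elim!: set_times_elim)
qed

text \<open>Turns containment in the inverse into the condition on generators that
  \<open>star_invertible\<close> uses.\<close>

lemma subset_inv_submodule_iff: "T \<subseteq> inv_submodule (Dmod.span S) \<longleftrightarrow> S * T \<subseteq> D_ring"
proof
  assume "T \<subseteq> inv_submodule (Dmod.span S)"
  then show "S * T \<subseteq> D_ring"
    using times_inv_submodule_subset set_times_mono2 by blast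
next
  assume ST: "S * T \<subseteq> D_ring"
  have "x * y \<in> D_ring" if "x \<in> T" "y \<in> S" for x y
    using ST set_times_intro[OF that(2,1)] by (metis mult.commute subsetD)
  then show "T \<subseteq> inv_submodule (Dmod.span S)"
    unfolding inv_submodule_span by blast
qed

lemma subspace_inv_submodule: "Dmod.subspace (inv_submodule (Dmod.span S))"
  unfolding inv_submodule_span by (intro subspace_residual subspace_D_ring)

lemma submodule_prod_inv_eq:
  "submodule_prod (Dmod.span S) (inv_submodule (Dmod.span S)) =
     Dmod.span (S * inv_submodule (Dmod.span S))"
  using submodule_prod_span[of S "inv_submodule (Dmod.span S)"]
    subspace_inv_submodule[of S, THEN Dmod.span_eq_iff[THEN iffD2]]
  by simp

text \<open>Explains the recurring hypothesis \<open>\<not> S \<subseteq> {0}\<close>: it excludes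
  the empty set as well as \<open>{0}\<close>, yet lets 0 occur among the generators.\<close>

lemma span_nonzero_iff: "Dmod.span S \<noteq> {0} \<longleftrightarrow> \<not> S \<subseteq> {0}"
proof
  show "\<not> S \<subseteq> {0} \<Longrightarrow> Dmod.span S \<noteq> {0}"
    using Dmod.span_superset[of S] by metis
  show "Dmod.span S \<noteq> {0} \<Longrightarrow> \<not> S \<subseteq> {0}"
    using Dmod.span_minimal[of S "{0}"] Dmod.subspace_single_0 Dmod.span_zero[of S] by blast
qed

lemma subset_zero_times_iff:
  "S * T \<subseteq> {0 :: 'a::idom fract} \<longleftrightarrow> S \<subseteq> {0} \<or> T \<subseteq> {0}"
proof
  assume ST: "S * T \<subseteq> {0}"
  have "x = 0 \<or> y = 0" if "x \<in> S" "y \<in> T" for x y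
    using ST set_times_intro[OF that] by auto
  then show "S \<subseteq> {0} \<or> T \<subseteq> {0}" by blast
next
  assume "S \<subseteq> {0} \<or> T \<subseteq> {0}"
  then show "S * T \<subseteq> {0}" by (auto elim!: set_times_elim)
qed

lemma span_in_nonzero_submodules [simp]: "Dmod.span S \<in> nonzero_submodules \<longleftrightarrow> \<not> S \<subseteq> {0}"
  by (simp add: nonzero_submodules_def span_nonzero_iff Dmod.subspace_span)

lemma nonzero_submodules_iff: "E \<in> nonzero_submodules \<longleftrightarrow> Dmod.subspace E \<and> \<not> E \<subseteq> {0}"
proof -
  have "E = {0} \<longleftrightarrow> E \<subseteq> {0}" if "Dmod.subspace E"
    using Dmod.subspace_0[OF that] by auto
  then show ?thesis
    unfolding nonzero_submodules_def by auto
qed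

lemma D_ring_in_nonzero_submodules [simp]: "D_ring \<in> nonzero_submodules"
  by (simp add: D_ring_eq_span)

lemma fg_submodules_iff:
  "E \<in> fg_submodules \<longleftrightarrow> (\<exists>S. finite S \<and> \<not> S \<subseteq> {0} \<and> E = Dmod.span S)"
proof -
  have "finite S \<and> E = Dmod.span S \<and> E \<noteq> {0} \<longleftrightarrow>
      finite S \<and> \<not> S \<subseteq> {0} \<and> E = Dmod.span S" for S
    using span_nonzero_iff[of S] by metis
  then show ?thesis
    unfolding fg_submodules_def mem_Collect_eq by (metis (no_types))
qed

lemma ball_fg_submodules:
  "(\<forall>E\<in>fg_submodules. P E) \<longleftrightarrow> (\<forall>S. finite S \<and> \<not> S \<subseteq> {0} \<longrightarrow> P (Dmod.span S))"
  unfolding Ball_def fg_submodules_iff by blast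

text \<open>A common denominator of the finitely many generators is a nonzero element of the
  inverse.\<close>

lemma inv_submodule_nonzero:
  assumes "finite S"
  shows "\<not> inv_submodule (Dmod.span S) \<subseteq> {0}"
proof -
  obtain d where d: "d \<noteq> 0" "{d} * S \<subseteq> D_ring"
    using ex_common_denominator[OF assms] .
  then have "{d} \<subseteq> inv_submodule (Dmod.span S)"
    unfolding subset_inv_submodule_iff by (simp add: mult.commute)
  then show ?thesis
    using d(1) by blast
qed

lemma inv_submodule_in_nonzero_submodules:
  "finite S \<Longrightarrow> inv_submodule (Dmod.span S) \<in> nonzero_submodules"
  using inv_submodule_nonzero subspace_inv_submodule unfolding nonzero_submodules_def by blast

lemma times_inv_submodule_nonzero:
  assumes "finite S" "\<not> S \<subseteq> {0}"
  shows "\<not> S * inv_submodule (Dmod.span S) \<subseteq> {0}"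
  using assms inv_submodule_nonzero by (simp add: subset_zero_times_iff)

lemma fg_in_nonzero_submodules: "E \<in> fg_submodules \<Longrightarrow> E \<in> nonzero_submodules"
  by (auto simp: fg_submodules_iff)

lemma Int_in_nonzero_submodules_iff:
  assumes "E \<in> nonzero_submodules" "F \<in> nonzero_submodules"
  shows "E \<inter> F \<in> nonzero_submodules \<longleftrightarrow> E \<inter> F \<noteq> {0}"
  using assms Dmod.subspace_inter[of E F] by (simp add: nonzero_submodules_def)

lemma inv_submodule_fg_in_nonzero_submodules:
  "F \<in> fg_submodules \<Longrightarrow> inv_submodule F \<in> nonzero_submodules"
  by (auto simp: fg_submodules_iff intro: inv_submodule_in_nonzero_submodules)

lemma
  assumes "finite S" "\<not> S \<subseteq> {0}"
  shows inv_prod_in_nonzero_submodules: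
      "submodule_prod (Dmod.span S) (inv_submodule (Dmod.span S)) \<in> nonzero_submodules"
    and inv_prod_subset_D_ring:
      "submodule_prod (Dmod.span S) (inv_submodule (Dmod.span S)) \<subseteq> D_ring"
  unfolding submodule_prod_inv_eq span_in_nonzero_submodules
  using times_inv_submodule_nonzero[OF assms]
  by (auto intro!: subsetD[OF Dmod.span_minimal[OF times_inv_submodule_subset subspace_D_ring]])

lemma subset_of_one_in:
  assumes "E \<in> nonzero_submodules" "1 \<in> E"
  shows "D_ring \<subseteq> E"
  using assms unfolding D_ring_eq_span by (intro Dmod.span_minimal) (auto simp: nonzero_submodules_iff)

subsection \<open>The closure of a set of generators\<close>

text \<open>
  The case distinction makes the closure laws hold for all sets, since a semistar operation is
  unconstrained on the zero module.
\<close>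

definition star_closure :: "('a::idom fract set \<Rightarrow> 'a fract set) \<Rightarrow> 'a fract set \<Rightarrow> 'a fract set"
  where "star_closure s S = (if S \<subseteq> {0} then {0} else s (Dmod.span S))"

text \<open>
  For finite \<open>S\<close> generating \<open>I\<close> this says that \<open>I I\<inverse>\<close> contains a finitely generated module whose
  closure contains 1, i.e. that \<open>I\<close> is invertible with respect to the finite type operation.
\<close>

definition star_invertible :: "('a::idom fract set \<Rightarrow> 'a fract set) \<Rightarrow> 'a fract set \<Rightarrow> bool"
  where "star_invertible s S \<longleftrightarrow>
    (\<exists>T. finite T \<and> S * T \<subseteq> D_ring \<and> 1 \<in> star_closure s (S * T))"

lemma star_span: "\<not> S \<subseteq> {0} \<Longrightarrow> s (Dmod.span S) = star_closure s S"
  by (simp add: star_closure_def)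

lemma star_invertible_nonzero:
  assumes "1 \<in> star_closure s (S * T)"
  shows "\<not> T \<subseteq> {0}"
proof
  assume "T \<subseteq> {0}"
  then have "S * T \<subseteq> {0}"
    by (simp add: subset_zero_times_iff)
  then show False
    using assms by (simp add: star_closure_def)
qed

lemma smult_set_eq: "smult_set y E = {y} * E"
  by (auto simp: smult_set_def set_times_def)

lemma subspace_smult_set:
  assumes "Dmod.subspace E"
  shows "Dmod.subspace (smult_set y E)"
proof -
  have "0 \<in> smult_set y E"
    using assms by (force simp: subspace_iff smult_set_def)
  moreover have "y * u + y * v \<in> smult_set y E" if "u \<in> E" "v \<in> E" for u v
    using Dmod.subspace_add[OF assms that] unfolding smult_set_def distrib_left[symmetric]
    by (rule imageI)
  moreover have "d * (y * u) \<in> smult_set y E" if "d \<in> D_ring" "u \<in> E" for d u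
    using subspace_mult[OF assms that] unfolding smult_set_def mult.left_commute[of d y]
    by (rule imageI)
  ultimately show ?thesis
    unfolding subspace_iff by (auto simp: smult_set_def)
qed

lemma span_scale_set: "Dmod.span ({y} * S) = smult_set y (Dmod.span S)"
proof
  have "{y} * S \<subseteq> {y} * Dmod.span S"
    by (intro set_times_mono2 Dmod.span_superset subset_refl)
  then show "Dmod.span ({y} * S) \<subseteq> smult_set y (Dmod.span S)"
    unfolding smult_set_eq[symmetric]
    by (intro Dmod.span_minimal subspace_smult_set Dmod.subspace_span) (simp add: smult_set_eq)
  have "{y} * Dmod.span S \<subseteq> Dmod.span {y} * Dmod.span S"
    by (intro set_times_mono2 Dmod.span_superset subset_refl)
  also have "\<dots> \<subseteq> Dmod.span ({y} * S)"
    by (intro span_times_span_subset Dmod.subspace_span Dmod.span_superset)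
  finally show "smult_set y (Dmod.span S) \<subseteq> Dmod.span ({y} * S)"
    by (simp add: smult_set_eq)
qed

section \<open>Closure laws of a semistar operation\<close>

locale semistar_operation =
  fixes s :: "'a::idom fract set \<Rightarrow> 'a fract set"
  assumes semistar: "semistar s"
begin

lemma star_in_nonzero_submodules: "E \<in> nonzero_submodules \<Longrightarrow> s E \<in> nonzero_submodules"
  using semistar by (simp add: semistar_def)

lemma star_scale: "E \<in> nonzero_submodules \<Longrightarrow> x \<noteq> 0 \<Longrightarrow> s (smult_set x E) = smult_set x (s E)"
  using semistar by (simp add: semistar_def)

lemma star_idem: "E \<in> nonzero_submodules \<Longrightarrow> s (s E) = s E"
  using semistar by (simp add: semistar_def)

lemma star_extensive: "E \<in> nonzero_submodules \<Longrightarrow> E \<subseteq> s E"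
  using semistar by (simp add: semistar_def)

lemma star_mono:
  "E \<in> nonzero_submodules \<Longrightarrow> F \<in> nonzero_submodules \<Longrightarrow> E \<subseteq> F \<Longrightarrow> s E \<subseteq> s F"
  using semistar by (simp add: semistar_def)

lemma star_least:
  "E \<in> nonzero_submodules \<Longrightarrow> F \<in> nonzero_submodules \<Longrightarrow> E \<subseteq> s F \<Longrightarrow> s E \<subseteq> s F"
  using star_mono[of E "s F"] star_idem[of F] star_in_nonzero_submodules[of F] by simp

lemma star_closure_nonzero_submodule: "E \<in> nonzero_submodules \<Longrightarrow> s E = star_closure s E"
  by (simp add: nonzero_submodules_iff star_closure_def Dmod.span_eq_iff[THEN iffD2])

lemma subspace_star_closure: "Dmod.subspace (star_closure s S)"
  using star_in_nonzero_submodules[of "Dmod.span S"] Dmod.subspace_single_0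
  unfolding span_in_nonzero_submodules by (simp add: star_closure_def nonzero_submodules_iff)

lemma subset_star_closure: "S \<subseteq> star_closure s S"
proof (cases "S \<subseteq> {0}")
  case False
  then have "Dmod.span S \<subseteq> star_closure s S"
    using star_extensive[of "Dmod.span S"] by (simp add: star_span)
  then show ?thesis
    using Dmod.span_superset by (rule order_trans[rotated])
qed (simp add: star_closure_def)

text \<open>Packs monotonicity and idempotence into one rule; with
  \<open>subset_star_closure\<close> it makes \<open>star_closure s\<close> a closure operator on
  arbitrary sets.\<close>

lemma star_closure_least:
  assumes "S \<subseteq> star_closure s T"
  shows "star_closure s S \<subseteq> star_closure s T"
proof (cases "S \<subseteq> {0}")
  case True
  then show ?thesis
    using Dmod.subspace_0[OF subspace_star_closure[of T]] by (simp add: star_closure_def[of s S])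
next
  case False
  then have T: "\<not> T \<subseteq> {0}"
    using assms by (auto simp: star_closure_def)
  have "Dmod.span S \<subseteq> star_closure s T"
    using assms subspace_star_closure by (intro Dmod.span_minimal)
  then show ?thesis
    using star_least[of "Dmod.span S" "Dmod.span T"] False T by (simp add: star_span)
qed

lemma star_closure_mono: "S \<subseteq> T \<Longrightarrow> star_closure s S \<subseteq> star_closure s T"
  by (meson star_closure_least subset_star_closure order_trans)

lemma star_closure_span [simp]: "star_closure s (Dmod.span S) = star_closure s S"
  using span_in_nonzero_submodules[of S] nonzero_submodules_iff[of "Dmod.span S"]
  by (simp add: star_closure_def Dmod.span_span)

lemma star_closure_scale:
  assumes "x \<in> star_closure s S"
  shows "x * y \<in> star_closure s (S * {y})"
\<comment> \<open>The scaling law of \<open>semistar\<close> requires a nonzero factor and a nonzero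
  module; in the remaining cases the product is 0.\<close>
proof (cases "y = 0 \<or> S \<subseteq> {0}")
  case True
  then have xy: "x * y = 0"
  proof
    assume "S \<subseteq> {0}"
    then have "x = 0"
      using assms by (simp add: star_closure_def)
    then show ?thesis by simp
  qed simp
  show ?thesis
    unfolding xy by (rule Dmod.subspace_0[OF subspace_star_closure])
next
  case False
  then have "\<not> {y} * S \<subseteq> {0}"
    by (simp add: subset_zero_times_iff)
  then have "star_closure s ({y} * S) = s (smult_set y (Dmod.span S))"
    unfolding span_scale_set[symmetric] by (rule star_span[symmetric])
  also have "\<dots> = smult_set y (s (Dmod.span S))"
    using False by (intro star_scale) simp_all
  also have "s (Dmod.span S) = star_closure s S"
    using False by (intro star_span) simp
  finally have "y * x \<in> star_closure s ({y} * S)"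
    using assms unfolding smult_set_def by blast
  then show ?thesis
    unfolding mult.commute[of x y] mult.commute[of S "{y}"] .
qed

text \<open>Scaling puts \<open>x * y\<close> into the closure of \<open>S * {y}\<close>, so
  multiplication into a closed module need only be checked on generators.\<close>

lemma star_closure_times_left:
  assumes "x \<in> star_closure s S" "\<And>z. z \<in> S \<Longrightarrow> z * y \<in> star_closure s U"
  shows "x * y \<in> star_closure s U"
proof -
  have "S * {y} \<subseteq> star_closure s U"
    using assms(2) by (auto elim!: set_times_elim)
  then show ?thesis
    using star_closure_scale[OF assms(1)] star_closure_least by blast
qed

text \<open>Each factor in turn is reduced to its generators by
  \<open>star_closure_times_left\<close>.\<close>

lemma star_closure_times:
  "star_closure s S * star_closure s T \<subseteq> star_closure s (S * T)"
proof -
  have "x * y \<in> star_closure s (S * T)" if "x \<in> star_closure s S" "y \<in> star_closure s T" for x y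
  proof (rule star_closure_times_left[OF that(1)])
    fix a assume a: "a \<in> S"
    have "y * a \<in> star_closure s (S * T)"
    proof (rule star_closure_times_left[OF that(2)])
      fix b assume "b \<in> T"
      then have "a * b \<in> star_closure s (S * T)"
        using subset_star_closure[of "S * T"] set_times_intro[OF a] by blast
      then show "b * a \<in> star_closure s (S * T)"
        by (simp add: mult.commute)
    qed
    then show "a * y \<in> star_closure s (S * T)"
      by (simp add: mult.commute)
  qed
  then show ?thesis by (auto elim!: set_times_elim)
qed

lemma one_in_star_closure_times:
  assumes "1 \<in> star_closure s S" "1 \<in> star_closure s T"
  shows "1 \<in> star_closure s (S * T)"
  using set_times_intro[OF assms] star_closure_times by auto

text \<open>The union of finitely many finite witnesses is one finite witness for all elements of
  \<open>U\<close>; this drives every finite type argument below.\<close>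

lemma finite_subset_star_closures:
  assumes "finite U" "\<And>u. u \<in> U \<Longrightarrow> \<exists>T. finite T \<and> T \<subseteq> E \<and> u \<in> star_closure s T"
  obtains T where "finite T" "T \<subseteq> E" "U \<subseteq> star_closure s T"
proof -
  obtain T where T: "\<And>u. u \<in> U \<Longrightarrow> finite (T u) \<and> T u \<subseteq> E \<and> u \<in> star_closure s (T u)"
    using assms(2) by metis
  have "u \<in> star_closure s (\<Union>(T ` U))" if "u \<in> U" for u
    using T[OF that] star_closure_mono[of "T u" "\<Union>(T ` U)"] that by blast
  moreover have "finite (\<Union>(T ` U))" "\<Union>(T ` U) \<subseteq> E"
    using T assms(1) by auto
  ultimately show thesis
    using that by blast
qed

section \<open>The finite type operation\<close>

lemma star_f_iff:
  assumes "E \<in> nonzero_submodules"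
  shows "x \<in> star_f s E \<longleftrightarrow> (\<exists>T. finite T \<and> T \<subseteq> E \<and> x \<in> star_closure s T)"
proof
  assume "x \<in> star_f s E"
  then obtain F where F: "F \<in> fg_submodules" "F \<subseteq> E" "x \<in> s F"
    unfolding star_f_def by blast
  obtain S where "finite S" "\<not> S \<subseteq> {0}" "F = Dmod.span S"
    using F(1) unfolding fg_submodules_iff by metis
  then show "\<exists>T. finite T \<and> T \<subseteq> E \<and> x \<in> star_closure s T"
    using Dmod.span_superset[of S] F by (intro exI[of _ S]) (auto simp: star_span)
next
  assume "\<exists>T. finite T \<and> T \<subseteq> E \<and> x \<in> star_closure s T"
  then obtain T where T: "finite T" "T \<subseteq> E" "x \<in> star_closure s T" by blast
  obtain e where e: "e \<in> E" "e \<noteq> 0" and E: "Dmod.subspace E"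
    using assms unfolding nonzero_submodules_iff by blast
  \<comment> \<open>Adjoining the nonzero \<open>e\<close> keeps the span in
    \<open>fg_submodules\<close> even when \<open>T\<close> lies in \<open>{0}\<close>.\<close>
  let ?S = "insert e T"
  have S: "finite ?S" "\<not> ?S \<subseteq> {0}"
    using T e by auto
  then have "Dmod.span ?S \<in> fg_submodules"
    unfolding fg_submodules_iff by metis
  moreover have "Dmod.span ?S \<subseteq> E"
    using e T E by (intro Dmod.span_minimal) auto
  moreover have "x \<in> s (Dmod.span ?S)"
    using S(2) T(3) star_closure_mono[of T ?S] by (auto simp: star_span)
  ultimately show "x \<in> star_f s E"
    unfolding star_f_def by blast
qed

text \<open>Monotonicity and idempotence of \<open>star_f s\<close> in one rule: the finite witness
  in \<open>F\<close> is itself covered by the closure of one finite subset of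
  \<open>E\<close>.\<close>

lemma star_f_least:
  assumes "E \<in> nonzero_submodules" "F \<in> nonzero_submodules" "F \<subseteq> star_f s E"
  shows "star_f s F \<subseteq> star_f s E"
proof
  fix x assume "x \<in> star_f s F"
  then obtain T where T: "finite T" "T \<subseteq> F" "x \<in> star_closure s T"
    unfolding star_f_iff[OF assms(2)] by blast
  obtain U where U: "finite U" "U \<subseteq> E" "T \<subseteq> star_closure s U"
  proof (rule finite_subset_star_closures[OF T(1), of E])
    show "\<exists>U. finite U \<and> U \<subseteq> E \<and> u \<in> star_closure s U" if "u \<in> T" for u
      using T(2) assms(3) that star_f_iff[OF assms(1), of u] by auto
  qed
  then have "x \<in> star_closure s U"
    using T(3) star_closure_least[OF U(3)] by auto
  then show "x \<in> star_f s E"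
    unfolding star_f_iff[OF assms(1)] using U by auto
qed

lemma star_f_extensive:
  assumes "E \<in> nonzero_submodules"
  shows "E \<subseteq> star_f s E"
proof
  fix x assume "x \<in> E"
  then show "x \<in> star_f s E"
    unfolding star_f_iff[OF assms] using subset_star_closure[of "{x}"]
    by (intro exI[of _ "{x}"]) auto
qed

lemma star_f_subset:
  assumes "E \<in> nonzero_submodules"
  shows "star_f s E \<subseteq> s E"
proof
  fix x assume "x \<in> star_f s E"
  then obtain T where "T \<subseteq> E" "x \<in> star_closure s T"
    unfolding star_f_iff[OF assms] by auto
  then show "x \<in> s E"
    unfolding star_closure_nonzero_submodule[OF assms] using star_closure_mono[of T E] by auto
qed

lemma star_f_span:
  assumes "finite S" "\<not> S \<subseteq> {0}"
  shows "star_f s (Dmod.span S) = star_closure s S"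
proof
  have S: "Dmod.span S \<in> nonzero_submodules"
    using assms by simp
  show "star_f s (Dmod.span S) \<subseteq> star_closure s S"
    using star_f_subset[OF S] assms by (simp add: star_span)
  show "star_closure s S \<subseteq> star_f s (Dmod.span S)"
    unfolding subset_iff star_f_iff[OF S] using assms Dmod.span_superset[of S] by auto
qed

lemma star_f_fg: "E \<in> fg_submodules \<Longrightarrow> star_f s E = s E"
  unfolding fg_submodules_iff by (metis star_f_span star_span)

lemma star_f_D_ring [simp]: "star_f s D_ring = s D_ring"
  using star_f_span[of "{1}"] star_span[of "{1}" s] by (simp add: D_ring_eq_span)

lemma star_f_in_nonzero_submodules:
  assumes "E \<in> nonzero_submodules"
  shows "star_f s E \<in> nonzero_submodules"
  unfolding nonzero_submodules_iff subspace_iff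
proof (intro conjI ballI)
  note iff = star_f_iff[OF assms]
  have E: "Dmod.subspace E" "\<not> E \<subseteq> {0}"
    using assms by (auto simp: nonzero_submodules_iff)
  then show "0 \<in> star_f s E" "\<not> star_f s E \<subseteq> {0}"
    using Dmod.subspace_0[OF E(1)] star_f_extensive[OF assms] by blast+
  fix x assume x: "x \<in> star_f s E"
  show "x + y \<in> star_f s E" if y: "y \<in> star_f s E" for y
  proof -
    \<comment> \<open>Closure under addition needs a single finite witness for both
      summands.\<close>
    obtain T where "finite T" "T \<subseteq> E" and T: "{x, y} \<subseteq> star_closure s T"
    proof (rule finite_subset_star_closures[of "{x, y}" E])
      show "\<exists>T. finite T \<and> T \<subseteq> E \<and> u \<in> star_closure s T" if "u \<in> {x, y}" for u
        using x y that unfolding iff by blast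
    qed simp
    then show ?thesis
      using Dmod.subspace_add[OF subspace_star_closure, of x T y] unfolding iff by blast
  qed
  show "d * x \<in> star_f s E" if "d \<in> D_ring" for d
    using x subspace_mult[OF subspace_star_closure that] unfolding iff by blast
qed

end

subsection \<open>The stable operation of finite type\<close>

lemma nonzero_ideal_iff:
  "nonzero_ideal I \<longleftrightarrow> Dmod.subspace I \<and> \<not> I \<subseteq> {0} \<and> I \<subseteq> D_ring"
  by (auto simp: nonzero_ideal_def nonzero_submodules_iff)

lemma ideal_eq_D_ring_iff:
  assumes "nonzero_ideal I"
  shows "I = D_ring \<longleftrightarrow> 1 \<in> I"
proof
  assume "1 \<in> I"
  then have "d \<in> I" if "d \<in> D_ring" for d
    using assms subspace_mult[of I d 1] that by (simp add: nonzero_ideal_iff)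
  then show "I = D_ring"
    using assms by (auto simp: nonzero_ideal_iff)
qed simp

text \<open>The elements with a denominator outside \<open>M\<close> form a submodule containing the
  generating products; conversely \<open>x = (t * x) * (1 / t)\<close>. That 0 lies in
  \<open>M\<close> keeps denominators nonzero.\<close>

lemma submodule_prod_D_localization_iff:
  assumes E: "Dmod.subspace E"
    and M: "1 \<notin> M" "0 \<in> M" "\<And>a b. \<lbrakk>a \<in> D_ring - M; b \<in> D_ring - M\<rbrakk> \<Longrightarrow> a * b \<notin> M"
  shows "x \<in> submodule_prod E (D_localization M) \<longleftrightarrow> (\<exists>t\<in>D_ring - M. t * x \<in> E)"
proof
  let ?V = "{x. \<exists>t\<in>D_ring - M. t * x \<in> E}"
  have mult: "a * b \<in> D_ring - M" if "a \<in> D_ring - M" "b \<in> D_ring - M" for a b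
    using that M(3) D_ring_mult by blast
  have "Dmod.subspace ?V"
    unfolding subspace_iff
  proof (intro conjI ballI)
    show "0 \<in> ?V"
      using M(1) Dmod.subspace_0[OF E] by (intro CollectI bexI[of _ 1]) auto
  next
    fix x y assume "x \<in> ?V" "y \<in> ?V"
    then obtain t u where t: "t \<in> D_ring - M" "t * x \<in> E" and u: "u \<in> D_ring - M" "u * y \<in> E"
      by auto
    \<comment> \<open>The common denominator \<open>t * u\<close> avoids \<open>M\<close> by
      multiplicativity of the complement.\<close>
    have "u * (t * x) + t * (u * y) \<in> E"
      using t u by (simp add: Dmod.subspace_add[OF E] subspace_mult[OF E])
    then have "(t * u) * (x + y) \<in> E"
      by (simp add: algebra_simps)
    then show "x + y \<in> ?V"
      using mult[OF t(1) u(1)] by blast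
  next
    fix d x :: "'a fract" assume d: "d \<in> D_ring" and "x \<in> ?V"
    then obtain t where t: "t \<in> D_ring - M" "t * x \<in> E"
      by auto
    then have "t * (d * x) \<in> E"
      using subspace_mult[OF E d t(2)] by (simp add: mult.left_commute)
    then show "d * x \<in> ?V"
      using t(1) by blast
  qed
  moreover have "E * D_localization M \<subseteq> ?V"
  proof
    fix z assume "z \<in> E * D_localization M"
    then obtain e a t where z: "z = e * (a / t)" "e \<in> E" "a \<in> D_ring" "t \<in> D_ring - M"
      unfolding D_localization_def by (auto elim!: set_times_elim)
    then have "t * z = a * e"
      using M(2) by (cases "t = 0") auto
    then have "t * z \<in> E"
      using subspace_mult[OF E z(3,2)] by simp
    then show "z \<in> ?V"
      using z(4) by blast
  qed
  ultimately have "submodule_prod E (D_localization M) \<subseteq> ?V"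
    unfolding submodule_prod_eq by (intro Dmod.span_minimal)
  then show "\<exists>t\<in>D_ring - M. t * x \<in> E" if "x \<in> submodule_prod E (D_localization M)"
    using that by auto
next
  assume "\<exists>t\<in>D_ring - M. t * x \<in> E"
  then obtain t where t: "t \<in> D_ring - M" "t * x \<in> E" by auto
  have "1 / t \<in> D_localization M"
    using t(1) unfolding D_localization_def by (intro CollectI exI[of _ 1] exI[of _ t]) auto
  then have "(t * x) * (1 / t) \<in> E * D_localization M"
    using t(2) by (intro set_times_intro)
  moreover have "(t * x) * (1 / t) = x"
    using t(1) M(2) by auto
  ultimately show "x \<in> submodule_prod E (D_localization M)"
    unfolding submodule_prod_eq by (metis Dmod.span_base)
qed

context semistar_operation
begin

section \<open>Maximal quasi-ideals of the finite type operation: existence and primality\<close>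

lemma quasi_star_ideal_star_f_Int:
  assumes I: "nonzero_ideal I"
  shows "quasi_star_ideal (star_f s) (star_f s I \<inter> D_ring)"
proof -
  let ?J = "star_f s I \<inter> D_ring"
  have I': "I \<in> nonzero_submodules" "I \<subseteq> ?J"
    using I star_f_extensive by (auto simp: nonzero_ideal_def)
  have "star_f s I \<in> nonzero_submodules"
    using star_f_in_nonzero_submodules[OF I'(1)] .
  then have "Dmod.subspace ?J"
    using subspace_D_ring by (intro Dmod.subspace_inter) (auto simp: nonzero_submodules_iff)
  then have J: "nonzero_ideal ?J"
    using I I'(2) unfolding nonzero_ideal_iff by auto
  then have "?J \<in> nonzero_submodules"
    by (simp add: nonzero_ideal_def)
  then have "star_f s ?J \<subseteq> star_f s I" "?J \<subseteq> star_f s ?J"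
    using star_f_least[OF I'(1)] star_f_extensive by auto
  then show ?thesis
    using J by (auto simp: quasi_star_ideal_def)
qed

text \<open>Zorn's lemma applies because \<open>star_f s\<close> depends only on finite subsets, and
  a finite subset of the union of a chain lies in one member. Properness passes to the union since
  it says that 1 is missing.\<close>

lemma ex_quasi_star_max_ideal:
  assumes I: "nonzero_ideal I" "1 \<notin> star_f s I"
  obtains M where "M \<in> quasi_star_max_ideals (star_f s)" "I \<subseteq> M"
proof -
  let ?A = "{J. quasi_star_ideal (star_f s) J \<and> J \<noteq> D_ring \<and> I \<subseteq> J}"
  have one: "1 \<notin> J" if "J \<in> ?A" for J
    using that ideal_eq_D_ring_iff[of J] by (auto simp: quasi_star_ideal_def)
  have "I \<in> nonzero_submodules"
    using I(1) by (simp add: nonzero_ideal_def)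
  then have "star_f s I \<inter> D_ring \<in> ?A"
    using I quasi_star_ideal_star_f_Int[OF I(1)] star_f_extensive[of I] one_in_D_ring
    by (auto simp: nonzero_ideal_iff)
  then have "?A \<noteq> {}" by auto
  moreover have "\<Union>C \<in> ?A" if "C \<noteq> {}" and C: "subset.chain ?A C" for C
  proof -
    have CA: "C \<subseteq> ?A"
      using C by (simp add: subset.chain_def)
    have ideal: "nonzero_ideal J" "star_f s J \<inter> D_ring = J" if "J \<in> C" for J
      using CA that by (auto simp: quasi_star_ideal_def)
    have sub: "\<exists>J\<in>C. T \<subseteq> J" if "finite T" "T \<subseteq> \<Union>C" for T
      using finite_subset_Union_chain[OF that \<open>C \<noteq> {}\<close> C] by metis
    have "Dmod.subspace (\<Union>C)"
      unfolding subspace_iff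
    proof (intro conjI ballI)
      show "0 \<in> \<Union>C"
        using \<open>C \<noteq> {}\<close> ideal(1) Dmod.subspace_0 by (auto simp: nonzero_ideal_iff)
    next
      fix x y assume "x \<in> \<Union>C" "y \<in> \<Union>C"
      then obtain J where "J \<in> C" "{x, y} \<subseteq> J"
        using sub[of "{x, y}"] by auto
      then show "x + y \<in> \<Union>C"
        using ideal(1)[of J] Dmod.subspace_add[of J x y] by (auto simp: nonzero_ideal_iff)
    next
      fix d x :: "'a fract" assume "d \<in> D_ring" "x \<in> \<Union>C"
      then show "d * x \<in> \<Union>C"
        using ideal(1) subspace_mult[of _ d x] by (auto simp: nonzero_ideal_iff)
    qed
    then have nz: "nonzero_ideal (\<Union>C)"
      using ideal(1) \<open>C \<noteq> {}\<close> unfolding nonzero_ideal_iff by blast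
    then have nz': "\<Union>C \<in> nonzero_submodules"
      by (simp add: nonzero_ideal_def)
    have "star_f s (\<Union>C) \<inter> D_ring \<subseteq> \<Union>C"
    proof
      fix x assume x: "x \<in> star_f s (\<Union>C) \<inter> D_ring"
      then obtain T where T: "finite T" "T \<subseteq> \<Union>C" "x \<in> star_closure s T"
        using star_f_iff[OF nz'] by auto
      obtain J where J: "J \<in> C" "T \<subseteq> J"
        using sub[OF T(1,2)] by auto
      have "J \<in> nonzero_submodules"
        using ideal(1)[OF J(1)] by (simp add: nonzero_ideal_def)
      then have "x \<in> star_f s J"
        using star_f_iff T J by auto
      then show "x \<in> \<Union>C"
        using ideal(2)[OF J(1)] J(1) x by auto
    qed
    then have "quasi_star_ideal (star_f s) (\<Union>C)"
      using nz star_f_extensive[OF nz'] by (auto simp: quasi_star_ideal_def nonzero_ideal_def)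
    moreover have "1 \<notin> \<Union>C"
      using one CA by auto
    moreover have "I \<subseteq> \<Union>C"
      using \<open>C \<noteq> {}\<close> CA by auto
    ultimately show ?thesis
      using one_in_D_ring by auto
  qed
  ultimately obtain M where M: "M \<in> ?A" "\<forall>X\<in>?A. M \<subseteq> X \<longrightarrow> X = M"
    using subset_Zorn_nonempty[of ?A] by auto
  then have "M \<in> quasi_star_max_ideals (star_f s)"
    unfolding quasi_star_max_ideals_def by auto
  then show thesis
    using M(1) that by auto
qed

text \<open>Maximality forces 1 into the closure of the ideal generated by \<open>a\<close> and
  \<open>M\<close>. If \<open>a * b\<close> were in \<open>M\<close>, multiplication by
  \<open>b\<close> would carry this ideal into \<open>M\<close>, hence \<open>b\<close> into the
  closure of \<open>M\<close> and so into \<open>M\<close>.\<close>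

lemma quasi_star_max_ideal_prime:
  assumes M: "M \<in> quasi_star_max_ideals (star_f s)"
    and a: "a \<in> D_ring - M" and b: "b \<in> D_ring - M"
  shows "a * b \<notin> M"
proof
  assume ab: "a * b \<in> M"
  have q: "nonzero_ideal M" "star_f s M \<inter> D_ring = M"
    and max: "\<And>I. \<lbrakk>quasi_star_ideal (star_f s) I; I \<noteq> D_ring; M \<subseteq> I\<rbrakk> \<Longrightarrow> I = M"
    using M unfolding quasi_star_max_ideals_def quasi_star_ideal_def by simp_all
  let ?I = "Dmod.span (insert a M)"
  have "?I \<subseteq> D_ring"
    using a q(1) by (intro Dmod.span_minimal subspace_D_ring) (auto simp: nonzero_ideal_iff)
  moreover have I: "?I \<in> nonzero_submodules"
    using q(1) by (auto simp: nonzero_ideal_iff)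
  ultimately have nz: "nonzero_ideal ?I"
    by (simp add: nonzero_ideal_def)
  have "insert a M \<subseteq> star_f s ?I \<inter> D_ring"
    using star_f_extensive[OF I] Dmod.span_superset[of "insert a M"] \<open>?I \<subseteq> D_ring\<close> by auto
  then have "star_f s ?I \<inter> D_ring \<noteq> M" "M \<subseteq> star_f s ?I \<inter> D_ring"
    using a by blast+
  then have "star_f s ?I \<inter> D_ring = D_ring"
    using max[OF quasi_star_ideal_star_f_Int[OF nz]] by metis
  then have "1 \<in> star_f s ?I"
    using one_in_D_ring by (metis IntD1)
  then obtain T where T: "finite T" "T \<subseteq> ?I" "1 \<in> star_closure s T"
    unfolding star_f_iff[OF I] by auto
  have "?I * {b} \<subseteq> M"
  proof -
    have "z * b \<in> M" if "z \<in> insert a M" for z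
    proof (cases "z = a")
      case False
      then have "b * z \<in> M"
        using b q(1) that subspace_mult[of M b z] by (simp add: nonzero_ideal_iff)
      then show ?thesis by (simp only: mult.commute)
    qed (simp add: ab)
    then have "insert a M * {b} \<subseteq> M"
      by (auto elim!: set_times_elim)
    then have "?I * Dmod.span {b} \<subseteq> M"
      using q(1) by (intro span_times_span_subset) (auto simp: nonzero_ideal_iff)
    then show ?thesis
      using set_times_mono2[OF subset_refl Dmod.span_superset] by (rule order_trans[rotated])
  qed
  then have "T * {b} \<subseteq> M"
    using set_times_mono2[OF T(2) subset_refl] by (rule order_trans[rotated])
  moreover have "1 * b \<in> star_closure s (T * {b})"
    using T(3) by (rule star_closure_scale)
  moreover have "M \<in> nonzero_submodules"
    using q(1) by (simp add: nonzero_ideal_def)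
  ultimately have "b \<in> star_f s M"
    using finite_set_times[OF T(1), of "{b}"] star_f_iff[of M b] by auto
  then show False
    using q(2) b by auto
qed

text \<open>Let \<open>I\<close> be the ideal of those elements of \<open>D_ring\<close> that carry
  \<open>x\<close> into \<open>E\<close>. Localizing at \<open>M\<close> captures \<open>x\<close>
  exactly when \<open>I\<close> is not contained in \<open>M\<close>, and no maximal quasi-ideal
  contains \<open>I\<close> exactly when 1 lies in \<open>star_f s I\<close>.\<close>

lemma star_tilde_iff:
  assumes E: "E \<in> nonzero_submodules"
  shows "x \<in> star_tilde s E \<longleftrightarrow>
    (\<exists>T. finite T \<and> T \<subseteq> D_ring \<and> 1 \<in> star_closure s T \<and> T * {x} \<subseteq> E)"
proof -
  have subE: "Dmod.subspace E" and "\<not> E \<subseteq> {0}"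
    using E by (auto simp: nonzero_submodules_iff)
  then obtain e where e: "e \<in> E" "e \<noteq> 0" by auto
  \<comment> \<open>A denominator of \<open>x / e\<close> carries \<open>x\<close> to a multiple of
    \<open>e\<close>, hence into \<open>E\<close>; this makes the ideal \<open>I\<close>
    nonzero.\<close>
  obtain d where d: "d \<in> D_ring" "d \<noteq> 0" "d * (x / e) \<in> D_ring"
    by (rule ex_denominator)
  have "d * x \<in> E"
    using subspace_mult[OF subE d(3) e(1)] e(2) by simp
  define I where "I = {t \<in> D_ring. t * x \<in> E}"
  have "Dmod.subspace I"
    using subE by (auto simp: I_def subspace_iff D_ring_add D_ring_mult distrib_right mult.assoc)
  moreover have "d \<in> I"
    using d \<open>d * x \<in> E\<close> by (simp add: I_def)
  ultimately have I: "nonzero_ideal I"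
    using d(2) by (auto simp: nonzero_ideal_iff I_def)
  then have I': "I \<in> nonzero_submodules"
    by (simp add: nonzero_ideal_def)
  have loc: "x \<in> submodule_prod E (D_localization M) \<longleftrightarrow> \<not> I \<subseteq> M"
    if M: "M \<in> quasi_star_max_ideals (star_f s)" for M
  proof -
    have q: "nonzero_ideal M" "M \<noteq> D_ring"
      using M by (auto simp: quasi_star_max_ideals_def quasi_star_ideal_def)
    then have "1 \<notin> M" "0 \<in> M"
      using ideal_eq_D_ring_iff[of M] Dmod.subspace_0[of M] by (auto simp: nonzero_ideal_iff)
    then show ?thesis
      using submodule_prod_D_localization_iff[OF subE, of M x] quasi_star_max_ideal_prime[OF M]
      by (auto simp: I_def)
  qed
  have "x \<in> star_tilde s E \<longleftrightarrow> (\<forall>M\<in>quasi_star_max_ideals (star_f s). \<not> I \<subseteq> M)"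
    using loc by (auto simp: star_tilde_def)
  also have "\<dots> \<longleftrightarrow> 1 \<in> star_f s I"
  proof
    assume "\<forall>M\<in>quasi_star_max_ideals (star_f s). \<not> I \<subseteq> M"
    then show "1 \<in> star_f s I"
      using ex_quasi_star_max_ideal[OF I] by auto
  next
    assume one: "1 \<in> star_f s I"
    show "\<forall>M\<in>quasi_star_max_ideals (star_f s). \<not> I \<subseteq> M"
    proof (intro ballI notI)
      fix M assume M: "M \<in> quasi_star_max_ideals (star_f s)" and "I \<subseteq> M"
      then have q: "nonzero_ideal M" "M \<noteq> D_ring" "star_f s M \<inter> D_ring = M"
        by (auto simp: quasi_star_max_ideals_def quasi_star_ideal_def)
      then have M': "M \<in> nonzero_submodules"
        by (simp add: nonzero_ideal_def)
      then have "star_f s I \<subseteq> star_f s M"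
        using \<open>I \<subseteq> M\<close> star_f_extensive[OF M'] by (intro star_f_least[OF M' I']) auto
      then have "1 \<in> M"
        using one q(3) one_in_D_ring by auto
      then show False
        using ideal_eq_D_ring_iff[OF q(1)] q(2) by simp
    qed
  qed
  also have "\<dots> \<longleftrightarrow> (\<exists>T. finite T \<and> T \<subseteq> I \<and> 1 \<in> star_closure s T)"
    by (rule star_f_iff[OF I'])
  also have "\<dots> \<longleftrightarrow> (\<exists>T. finite T \<and> T \<subseteq> D_ring \<and> 1 \<in> star_closure s T \<and> T * {x} \<subseteq> E)"
    by (rule ex_cong1) (auto simp: I_def elim!: set_times_elim)
  finally show ?thesis .
qed

section \<open>Laws of the stable operation and comparison with the finite type operation\<close>

lemma star_tilde_subset_star_f:
  assumes E: "E \<in> nonzero_submodules"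
  shows "star_tilde s E \<subseteq> star_f s E"
proof
  fix x assume "x \<in> star_tilde s E"
  then obtain T where T: "finite T" "1 \<in> star_closure s T" "T * {x} \<subseteq> E"
    using star_tilde_iff[OF E] by auto
  have "1 * x \<in> star_closure s (T * {x})"
    using T(2) by (rule star_closure_scale)
  then show "x \<in> star_f s E"
    using T(3) finite_set_times[OF T(1), of "{x}"] by (auto simp: star_f_iff[OF E])
qed

lemma star_tilde_extensive:
  assumes E: "E \<in> nonzero_submodules"
  shows "E \<subseteq> star_tilde s E"
proof
  fix x assume "x \<in> E"
  then show "x \<in> star_tilde s E"
    unfolding star_tilde_iff[OF E] using subset_star_closure[of "{1}"]
    by (intro exI[of _ "{1}"]) (auto elim!: set_times_elim)
qed

lemma star_tilde_mono:
  assumes "E \<in> nonzero_submodules" "F \<in> nonzero_submodules" "E \<subseteq> F"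
  shows "star_tilde s E \<subseteq> star_tilde s F"
  using assms(3) unfolding star_tilde_iff[OF assms(1)] star_tilde_iff[OF assms(2)] subset_iff
  by (metis subset_iff)

text \<open>If \<open>T\<close> carries \<open>x\<close> into \<open>E\<close> and \<open>U\<close>
  carries it into \<open>F\<close>, then \<open>T * U\<close> carries it into both, and its closure
  still contains 1. This stability makes coherence and true coherence agree for
  \<open>star_tilde s\<close>.\<close>

lemma star_tilde_Int:
  assumes E: "E \<in> nonzero_submodules" and F: "F \<in> nonzero_submodules"
    and EF: "E \<inter> F \<in> nonzero_submodules"
  shows "star_tilde s (E \<inter> F) = star_tilde s E \<inter> star_tilde s F"
proof
  show "star_tilde s (E \<inter> F) \<subseteq> star_tilde s E \<inter> star_tilde s F"
    using star_tilde_mono[OF EF E] star_tilde_mono[OF EF F] by auto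
  show "star_tilde s E \<inter> star_tilde s F \<subseteq> star_tilde s (E \<inter> F)"
  proof
    fix x assume "x \<in> star_tilde s E \<inter> star_tilde s F"
    then obtain T U where T: "finite T" "T \<subseteq> D_ring" "1 \<in> star_closure s T" "T * {x} \<subseteq> E"
      and U: "finite U" "U \<subseteq> D_ring" "1 \<in> star_closure s U" "U * {x} \<subseteq> F"
      using star_tilde_iff[OF E] star_tilde_iff[OF F] by auto
    have "t * u * x \<in> E \<inter> F" if "t \<in> T" "u \<in> U" for t u
    proof -
      have "t * x \<in> E" "u * x \<in> F"
        using T(4) U(4) that by (auto simp: subset_iff intro!: set_times_intro)
      then have "u * (t * x) \<in> E" "t * (u * x) \<in> F"
        using E F T(2) U(2) that subspace_mult[of E u "t * x"] subspace_mult[of F t "u * x"]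
        by (auto simp: nonzero_submodules_iff)
      then show ?thesis
        by (simp add: algebra_simps)
    qed
    then have "T * U * {x} \<subseteq> E \<inter> F"
      by (auto elim!: set_times_elim)
    moreover have "T * U \<subseteq> D_ring"
      using T(2) U(2) by (auto elim!: set_times_elim intro!: D_ring_mult)
    ultimately show "x \<in> star_tilde s (E \<inter> F)"
      unfolding star_tilde_iff[OF EF]
      using T U one_in_star_closure_times finite_set_times by metis
  qed
qed

text \<open>The uniform witness \<open>Q\<close> is multiplied with the witness \<open>T\<close> of
  a single element; this takes the place of idempotence of \<open>star_tilde s\<close>.\<close>

lemma star_tilde_subset_of_times:
  assumes E: "E \<in> nonzero_submodules" and F: "F \<in> nonzero_submodules"
    and Q: "finite Q" "Q \<subseteq> D_ring" "1 \<in> star_closure s Q" "Q * F \<subseteq> E"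
  shows "star_tilde s F \<subseteq> star_tilde s E"
proof
  fix x assume "x \<in> star_tilde s F"
  then obtain T where T: "finite T" "T \<subseteq> D_ring" "1 \<in> star_closure s T" "T * {x} \<subseteq> F"
    using star_tilde_iff[OF F] by auto
  have "Q * T * {x} \<subseteq> E"
    using set_times_mono2[OF subset_refl T(4), of Q] Q(4) by (simp add: mult.assoc)
  moreover have "Q * T \<subseteq> D_ring"
    using Q(2) T(2) by (auto elim!: set_times_elim intro!: D_ring_mult)
  ultimately show "x \<in> star_tilde s E"
    unfolding star_tilde_iff[OF E]
    using Q T one_in_star_closure_times finite_set_times by metis
qed

subsection \<open>Invertibility of finitely generated submodules\<close>

lemma star_eq_D_ring_iff:
  assumes E: "E \<in> nonzero_submodules" "E \<subseteq> D_ring"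
  shows "s E = s D_ring \<longleftrightarrow> 1 \<in> s E"
proof
  assume "1 \<in> s E"
  then have "D_ring \<subseteq> s E"
    using star_in_nonzero_submodules[OF E(1)] by (intro subset_of_one_in)
  then show "s E = s D_ring"
    using star_mono[OF E(1) D_ring_in_nonzero_submodules E(2)]
      star_least[OF D_ring_in_nonzero_submodules E(1)] by (intro subset_antisym)
next
  assume "s E = s D_ring"
  then show "1 \<in> s E"
    using star_extensive[OF D_ring_in_nonzero_submodules] one_in_D_ring by (metis subsetD)
qed

lemma star_f_eq_D_ring_iff:
  assumes E: "E \<in> nonzero_submodules" "E \<subseteq> D_ring"
  shows "star_f s E = s D_ring \<longleftrightarrow> 1 \<in> star_f s E"
proof
  assume "1 \<in> star_f s E"
  then have "D_ring \<subseteq> star_f s E"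
    using star_f_in_nonzero_submodules[OF E(1)] by (intro subset_of_one_in)
  then have "star_f s D_ring \<subseteq> star_f s E"
    by (intro star_f_least[OF E(1) D_ring_in_nonzero_submodules])
  moreover have "star_f s E \<subseteq> star_f s D_ring"
    using E(2) star_f_extensive[OF D_ring_in_nonzero_submodules]
    by (intro star_f_least[OF D_ring_in_nonzero_submodules E(1)]) (rule order_trans)
  ultimately show "star_f s E = s D_ring"
    by simp
next
  assume "star_f s E = s D_ring"
  then show "1 \<in> star_f s E"
    using star_extensive[OF D_ring_in_nonzero_submodules] one_in_D_ring by (metis subsetD)
qed

text \<open>A finite \<open>T \<subseteq> E\<close> with 1 in its closure multiplies
  \<open>D_ring\<close> into the ideal \<open>E\<close>, so it is also a witness for the stable
  operation. Hence both operations yield the same domain condition.\<close>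

lemma star_tilde_eq_D_ring_iff:
  assumes E: "E \<in> nonzero_submodules" "E \<subseteq> D_ring"
  shows "star_tilde s E = star_tilde s D_ring \<longleftrightarrow> 1 \<in> star_f s E"
proof
  assume "1 \<in> star_f s E"
  then obtain T where T: "finite T" "T \<subseteq> E" "1 \<in> star_closure s T"
    unfolding star_f_iff[OF E(1)] by auto
  have "d * t \<in> E" if "d \<in> D_ring" "t \<in> T" for d t
    using that E(1) T(2) subspace_mult[of E d t] by (auto simp: nonzero_submodules_iff)
  then have "T * D_ring \<subseteq> E"
    by (auto elim!: set_times_elim) (metis mult.commute)
  then have "star_tilde s D_ring \<subseteq> star_tilde s E"
    using T E(2) by (intro star_tilde_subset_of_times[of _ _ T]) (auto intro: E(1))
  then show "star_tilde s E = star_tilde s D_ring"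
    using star_tilde_mono[OF E(1) D_ring_in_nonzero_submodules E(2)] by (intro subset_antisym)
next
  assume "star_tilde s E = star_tilde s D_ring"
  then have "1 \<in> star_tilde s E"
    using star_tilde_extensive[OF D_ring_in_nonzero_submodules] one_in_D_ring by (metis subsetD)
  then show "1 \<in> star_f s E"
    using star_tilde_subset_star_f[OF E(1)] by (rule subsetD[rotated])
qed

text \<open>Finiteness passes through two layers: finitely many elements of the product module
  involve finitely many products, and these involve finitely many elements of the inverse.\<close>

lemma one_in_star_f_inv_prod_iff:
  assumes S: "finite S" "\<not> S \<subseteq> {0}"
  shows "1 \<in> star_f s (submodule_prod (Dmod.span S) (inv_submodule (Dmod.span S))) \<longleftrightarrow>
    star_invertible s S"
proof -
  let ?V = "inv_submodule (Dmod.span S)"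
  let ?P = "submodule_prod (Dmod.span S) (inv_submodule (Dmod.span S))"
  note iff = star_f_iff[OF inv_prod_in_nonzero_submodules[OF S]]
  show ?thesis
  proof
    assume "1 \<in> star_f s ?P"
    then obtain U where U: "finite U" "U \<subseteq> ?P" "1 \<in> star_closure s U"
      unfolding iff by auto
    obtain F where F: "finite F" "F \<subseteq> S * ?V" "U \<subseteq> Dmod.span F"
      using finite_subset_of_span[OF U(1) U(2)[unfolded submodule_prod_inv_eq]] .
    obtain T where T: "finite T" "T \<subseteq> ?V" "F \<subseteq> S * T"
      using finite_subset_of_times[OF F(1,2)] .
    have "U \<subseteq> Dmod.span (S * T)"
      using F(3) Dmod.span_mono[OF T(3)] by (rule order_trans)
    then have "star_closure s U \<subseteq> star_closure s (S * T)"
      using star_closure_mono[of U "Dmod.span (S * T)"] by simp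
    then show "star_invertible s S"
      unfolding star_invertible_def using U(3) T(1,2) by (auto simp: subset_inv_submodule_iff)
  next
    assume "star_invertible s S"
    then obtain T where T: "finite T" "S * T \<subseteq> D_ring" "1 \<in> star_closure s (S * T)"
      unfolding star_invertible_def by auto
    have "T \<subseteq> ?V"
      using T(2) by (simp add: subset_inv_submodule_iff)
    then have "S * T \<subseteq> ?P"
      unfolding submodule_prod_inv_eq
      using set_times_mono2[OF subset_refl, of T ?V S] Dmod.span_superset[of "S * ?V"]
      by (auto intro: order_trans)
    then show "1 \<in> star_f s ?P"
      unfolding iff using T(3) finite_set_times[OF S(1) T(1)] by auto
  qed
qed

text \<open>Differs from \<open>star_invertible\<close> in that the whole inverse replaces a finite
  subset of it; the coherence conditions serve to close this gap.\<close>

lemma star_domain_iff: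
  "star_domain s \<longleftrightarrow>
    (\<forall>S. finite S \<and> \<not> S \<subseteq> {0} \<longrightarrow> 1 \<in> star_closure s (S * inv_submodule (Dmod.span S)))"
proof -
  have "s (submodule_prod (Dmod.span S) (inv_submodule (Dmod.span S))) = s D_ring \<longleftrightarrow>
      1 \<in> star_closure s (S * inv_submodule (Dmod.span S))" if "finite S" "\<not> S \<subseteq> {0}" for S
    unfolding star_eq_D_ring_iff[OF inv_prod_in_nonzero_submodules[OF that]
        inv_prod_subset_D_ring[OF that]]
    unfolding submodule_prod_inv_eq star_span[OF times_inv_submodule_nonzero[OF that]] ..
  then show ?thesis
    unfolding star_domain_def ball_fg_submodules by auto
qed

lemma star_domain_star_f_iff:
  "star_domain (star_f s) \<longleftrightarrow> (\<forall>S. finite S \<and> \<not> S \<subseteq> {0} \<longrightarrow> star_invertible s S)"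
proof -
  have "star_f s (submodule_prod (Dmod.span S) (inv_submodule (Dmod.span S))) = star_f s D_ring \<longleftrightarrow>
      star_invertible s S" if "finite S" "\<not> S \<subseteq> {0}" for S
    unfolding star_f_D_ring one_in_star_f_inv_prod_iff[OF that, symmetric]
    by (rule star_f_eq_D_ring_iff[OF inv_prod_in_nonzero_submodules[OF that]
        inv_prod_subset_D_ring[OF that]])
  then show ?thesis
    unfolding star_domain_def ball_fg_submodules by auto
qed

lemma star_domain_star_tilde_iff:
  "star_domain (star_tilde s) \<longleftrightarrow> (\<forall>S. finite S \<and> \<not> S \<subseteq> {0} \<longrightarrow> star_invertible s S)"
proof -
  have "star_tilde s (submodule_prod (Dmod.span S) (inv_submodule (Dmod.span S))) =
      star_tilde s D_ring \<longleftrightarrow> star_invertible s S" if "finite S" "\<not> S \<subseteq> {0}" for S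
    unfolding one_in_star_f_inv_prod_iff[OF that, symmetric]
    by (rule star_tilde_eq_D_ring_iff[OF inv_prod_in_nonzero_submodules[OF that]
        inv_prod_subset_D_ring[OF that]])
  then show ?thesis
    unfolding star_domain_def ball_fg_submodules by auto
qed

lemma PsMD_iff: "PsMD s \<longleftrightarrow> (\<forall>S. finite S \<and> \<not> S \<subseteq> {0} \<longrightarrow> star_invertible s S)"
proof
  assume P: "PsMD s"
  show "\<forall>S. finite S \<and> \<not> S \<subseteq> {0} \<longrightarrow> star_invertible s S"
  proof (intro allI impI, elim conjE)
    fix S :: "'a fract set" assume S: "finite S" "\<not> S \<subseteq> {0}"
    \<comment> \<open>\<open>PsMD\<close> speaks of integral ideals only, so \<open>S\<close> is
      scaled into \<open>D_ring\<close>; at the end \<open>d\<close> moves over to the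
      witness.\<close>
    obtain d where d: "d \<in> D_ring" "d \<noteq> 0" "{d} * S \<subseteq> D_ring"
      using ex_common_denominator[OF S(1)] .
    let ?S = "{d} * S"
    have S': "finite ?S" "\<not> ?S \<subseteq> {0}"
      using S d(2) by (simp_all add: finite_set_times subset_zero_times_iff)
    then have "Dmod.span ?S \<in> fg_submodules"
      unfolding fg_submodules_iff by metis
    moreover have "nonzero_ideal (Dmod.span ?S)"
      unfolding nonzero_ideal_def using S'(2) Dmod.span_minimal[OF d(3) subspace_D_ring] by simp
    ultimately have "star_f s (submodule_prod (Dmod.span ?S) (inv_submodule (Dmod.span ?S))) = s D_ring"
      using P unfolding PsMD_def by metis
    then have "star_invertible s ?S"
      using star_f_eq_D_ring_iff[OF inv_prod_in_nonzero_submodules[OF S']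
        inv_prod_subset_D_ring[OF S']]
        one_in_star_f_inv_prod_iff[OF S'] by simp
    then obtain T where T: "finite T" "?S * T \<subseteq> D_ring" "1 \<in> star_closure s (?S * T)"
      unfolding star_invertible_def by auto
    have "?S * T = S * ({d} * T)"
      by (simp only: mult.assoc mult.left_commute)
    then show "star_invertible s S"
      unfolding star_invertible_def using T finite_set_times[of "{d}" T]
      by (intro exI[of _ "{d} * T"]) simp
  qed
next
  assume "\<forall>S. finite S \<and> \<not> S \<subseteq> {0} \<longrightarrow> star_invertible s S"
  then have "star_domain (star_f s)"
    by (simp add: star_domain_star_f_iff)
  then show "PsMD s"
    unfolding star_domain_def PsMD_def star_f_D_ring by auto
qed

text \<open>The generators of \<open>G\<close> lie in the closure of a finite subset
  \<open>L\<close> of the inverse, whose closure therefore covers the whole inverse. So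
  \<open>S * L\<close> can replace the product in the domain condition.\<close>

lemma star_invertible_of_approx:
  assumes D: "star_domain s" and S: "finite S" "\<not> S \<subseteq> {0}"
    and G: "G \<in> fg_submodules" "G \<subseteq> star_f s (inv_submodule (Dmod.span S))"
      "inv_submodule (Dmod.span S) \<subseteq> s G"
  shows "star_invertible s S"
proof -
  let ?V = "inv_submodule (Dmod.span S)"
  obtain W where W: "finite W" "\<not> W \<subseteq> {0}" "G = Dmod.span W"
    using G(1) unfolding fg_submodules_iff by auto
  have WV: "W \<subseteq> star_f s ?V"
    using G(2) Dmod.span_superset[of W] unfolding W(3) by auto
  obtain L where L: "finite L" "L \<subseteq> ?V" "W \<subseteq> star_closure s L"
  proof (rule finite_subset_star_closures[OF W(1), of ?V])
    show "\<exists>L. finite L \<and> L \<subseteq> ?V \<and> w \<in> star_closure s L" if "w \<in> W" for w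
      using WV that star_f_iff[OF inv_submodule_in_nonzero_submodules[OF S(1)], of w] by auto
  qed
  have "?V \<subseteq> star_closure s W"
    using G(3) unfolding W(3) star_span[OF W(2)] .
  then have V: "?V \<subseteq> star_closure s L"
    using star_closure_least[OF L(3)] by (rule order_trans)
  have "S * ?V \<subseteq> star_closure s S * star_closure s L"
    using subset_star_closure V by (rule set_times_mono2)
  also have "\<dots> \<subseteq> star_closure s (S * L)"
    by (rule star_closure_times)
  finally have "star_closure s (S * ?V) \<subseteq> star_closure s (S * L)"
    by (rule star_closure_least)
  then have "1 \<in> star_closure s (S * L)"
    using D S unfolding star_domain_iff by auto
  then show ?thesis
    unfolding star_invertible_def using L(1,2) by (auto simp: subset_inv_submodule_iff)
qed

text \<open>Pruefer's identity holds literally for sets of generators, with unions in place of sums.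
  It regroups the product of the three given witnesses into a witness for the union.\<close>

lemma star_invertible_Un:
  assumes fin: "finite A" "finite B" "finite C"
    and inv: "star_invertible s (A \<union> B)" "star_invertible s (B \<union> C)" "star_invertible s (C \<union> A)"
  shows "star_invertible s (A \<union> B \<union> C)"
proof -
  obtain T where T: "finite T" "(A \<union> B) * T \<subseteq> D_ring" "1 \<in> star_closure s ((A \<union> B) * T)"
    using inv(1) unfolding star_invertible_def by auto
  obtain U where U: "finite U" "(B \<union> C) * U \<subseteq> D_ring" "1 \<in> star_closure s ((B \<union> C) * U)"
    using inv(2) unfolding star_invertible_def by auto
  obtain V where V: "finite V" "(C \<union> A) * V \<subseteq> D_ring" "1 \<in> star_closure s ((C \<union> A) * V)"
    using inv(3) unfolding star_invertible_def by auto
  let ?X = "A * B \<union> B * C \<union> C * A"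
  have distrib: "(P \<union> Q) * R = P * R \<union> Q * R" "R * (P \<union> Q) = R * P \<union> R * Q"
    for P Q R :: "'a fract set"
    by (auto elim!: set_times_elim)
  have "(A \<union> B \<union> C) * ?X = (A \<union> B) * (B \<union> C) * (C \<union> A)"
    unfolding distrib by (simp add: mult.assoc mult.commute mult.left_commute) auto
  then have "(A \<union> B \<union> C) * (?X * (T * U * V)) = (A \<union> B) * (B \<union> C) * (C \<union> A) * (T * U * V)"
    by (simp only: mult.assoc[symmetric])
  also have "\<dots> = ((A \<union> B) * T) * ((B \<union> C) * U) * ((C \<union> A) * V)"
    by (simp only: mult.assoc mult.left_commute)
  finally have eq: "(A \<union> B \<union> C) * (?X * (T * U * V)) =
    ((A \<union> B) * T) * ((B \<union> C) * U) * ((C \<union> A) * V)" .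
  have D: "P * Q \<subseteq> D_ring" if "P \<subseteq> D_ring" "Q \<subseteq> D_ring" for P Q :: "'a fract set"
    using that D_ring_mult by (auto elim!: set_times_elim)
  have "finite (?X * (T * U * V))"
    using fin T(1) U(1) V(1) by (intro finite_set_times finite_UnI)
  moreover have "(A \<union> B \<union> C) * (?X * (T * U * V)) \<subseteq> D_ring"
    unfolding eq by (rule D[OF D[OF T(2) U(2)] V(2)])
  moreover have "1 \<in> star_closure s ((A \<union> B \<union> C) * (?X * (T * U * V)))"
    unfolding eq
    by (rule one_in_star_closure_times[OF one_in_star_closure_times[OF T(3) U(3)] V(3)])
  ultimately show ?thesis
    unfolding star_invertible_def by metis
qed

text \<open>Induction on the number of nonzero generators: split off \<open>a\<close> and
  \<open>b\<close>; if others remain, each pairwise union in \<open>star_invertible_Un\<close> omits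
  a generator.\<close>

lemma star_invertible_of_pairs:
  assumes pairs: "\<And>a b. a \<noteq> 0 \<Longrightarrow> b \<noteq> 0 \<Longrightarrow> star_invertible s {a, b}"
    and "finite S" "\<not> S \<subseteq> {0}"
  shows "star_invertible s S"
proof -
  have "star_invertible s S" if "finite S" "S \<noteq> {}" "0 \<notin> S" for S
    using that
  proof (induction "card S" arbitrary: S rule: less_induct)
    case less
    then obtain a where a: "a \<in> S" "a \<noteq> 0" by auto
    show ?case
    proof (cases "S \<subseteq> {a}")
      case True
      \<comment> \<open>A single generator counts as a degenerate pair.\<close>
      then have "S = {a, a}"
        using a by auto
      then show ?thesis
        using pairs[OF a(2) a(2)] by simp
    next
      case False
      then obtain b where b: "b \<in> S" "b \<noteq> a" by auto
      then have "b \<noteq> 0"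
        using less.prems(3) by metis
      show ?thesis
      proof (cases "S \<subseteq> {a, b}")
        case True
        then have "S = {a, b}"
          using a b by auto
        then show ?thesis
          using pairs[OF a(2) \<open>b \<noteq> 0\<close>] by simp
      next
        case False
        have IH: "star_invertible s (S - {c})" if "c \<in> S" for c
        proof (rule less.hyps)
          show "card (S - {c}) < card S"
            using less.prems(1) that by (rule card_Diff1_less)
          show "S - {c} \<noteq> {}"
            using that a b by auto
        qed (use less.prems in auto)
        have "star_invertible s ({a} \<union> {b} \<union> (S - {a, b}))"
        proof (rule star_invertible_Un)
          have "{b} \<union> (S - {a, b}) = S - {a}" "(S - {a, b}) \<union> {a} = S - {b}"
            using a b by auto
          then show "star_invertible s ({b} \<union> (S - {a, b}))" "star_invertible s ((S - {a, b}) \<union> {a})"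
            using IH[OF a(1)] IH[OF b(1)] by simp_all
          show "star_invertible s ({a} \<union> {b})"
            using pairs[OF a(2) \<open>b \<noteq> 0\<close>] by (simp add: insert_commute)
        qed (use less.prems in auto)
        moreover have "{a} \<union> {b} \<union> (S - {a, b}) = S"
          using a b by auto
        ultimately show ?thesis by simp
      qed
    qed
  qed
  moreover have "finite (S - {0})" "S - {0} \<noteq> {}" "0 \<notin> S - {0}"
    using assms by auto
  ultimately obtain T where T: "finite T" "(S - {0}) * T \<subseteq> D_ring" "1 \<in> star_closure s ((S - {0}) * T)"
    unfolding star_invertible_def by metis
  \<comment> \<open>The generator 0, removed for the induction, is restored: its products with
    \<open>T\<close> vanish.\<close>
  have "x * t \<in> D_ring" if "x \<in> S" "t \<in> T" for x t
    using that T(2) set_times_intro[of x "S - {0}" t T] by (cases "x = 0") auto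
  then have "S * T \<subseteq> D_ring"
    by (auto elim!: set_times_elim)
  moreover have "star_closure s ((S - {0}) * T) \<subseteq> star_closure s (S * T)"
    by (intro star_closure_mono set_times_mono2) auto
  ultimately show ?thesis
    unfolding star_invertible_def using T(1,3) by auto
qed

end

subsection \<open>Coherence conditions\<close>

lemma span_singleton_inverse: "a \<noteq> 0 \<Longrightarrow> Dmod.span {1 / a} = {x. x * a \<in> D_ring}"
proof (intro set_eqI iffI)
  fix x assume a: "a \<noteq> 0" and "x \<in> {x. x * a \<in> D_ring}"
  then obtain d where "x * a = to_fract d"
    by (auto simp: D_ring_def)
  then have "x = D_smult d (1 / a)"
    using a by (simp add: D_smult_def field_simps)
  then show "x \<in> Dmod.span {1 / a}"
    by (simp add: Dmod.span_singleton)
qed (auto simp: Dmod.span_singleton D_smult_def D_ring_def)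

lemma inv_submodule_pair:
  "a \<noteq> 0 \<Longrightarrow> b \<noteq> 0 \<Longrightarrow>
    inv_submodule (Dmod.span {a, b}) = Dmod.span {1 / a} \<inter> Dmod.span {1 / b}"
  by (auto simp: inv_submodule_span span_singleton_inverse)

lemma extracoherent_imp_coherent: "extracoherent t \<Longrightarrow> coherent t"
  unfolding extracoherent_def coherent_def by metis

context semistar_operation
begin

text \<open>The two bounds on \<open>J\<close> are what all the intersection conditions have in
  common. They are applied to the cyclic modules whose intersection is the inverse of
  \<open>(a, b)\<close>.\<close>

lemma PsMD_of_approx_Int:
  assumes D: "star_domain s"
    and approx: "\<And>E F. \<lbrakk>E \<in> fg_submodules; F \<in> fg_submodules; E \<inter> F \<in> nonzero_submodules\<rbrakk> \<Longrightarrow>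
      \<exists>J\<in>fg_submodules. J \<subseteq> star_f s (E \<inter> F) \<and> E \<inter> F \<subseteq> s J"
  shows "PsMD s"
proof -
  have pairs: "star_invertible s {a, b}" if ab: "a \<noteq> 0" "b \<noteq> 0" for a b
  proof -
    have fg: "Dmod.span {1 / c} \<in> fg_submodules" if "c \<noteq> 0" for c
      unfolding fg_submodules_iff using that by (intro exI[of _ "{1 / c}"]) simp
    have "inv_submodule (Dmod.span {a, b}) \<in> nonzero_submodules"
      by (rule inv_submodule_in_nonzero_submodules) simp
    then obtain J where "J \<in> fg_submodules" "J \<subseteq> star_f s (inv_submodule (Dmod.span {a, b}))"
      "inv_submodule (Dmod.span {a, b}) \<subseteq> s J"
      using approx[OF fg[OF ab(1)] fg[OF ab(2)]] unfolding inv_submodule_pair[OF ab] by auto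
    then show ?thesis
      using ab(1) by (intro star_invertible_of_approx[OF D]) auto
  qed
  show ?thesis
    unfolding PsMD_iff using star_invertible_of_pairs[OF pairs] by auto
qed

text \<open>Counterpart for the quasi-coherence conditions, which approximate the inverse for any
  number of generators at once.\<close>

lemma PsMD_of_approx_inv:
  assumes D: "star_domain s"
    and approx: "\<And>F. F \<in> fg_submodules \<Longrightarrow>
      \<exists>G\<in>fg_submodules. G \<subseteq> star_f s (inv_submodule F) \<and> inv_submodule F \<subseteq> s G"
  shows "PsMD s"
  unfolding PsMD_iff
proof (intro allI impI, elim conjE)
  fix S :: "'a fract set" assume S: "finite S" "\<not> S \<subseteq> {0}"
  then have "Dmod.span S \<in> fg_submodules"
    unfolding fg_submodules_iff by metis
  then show "star_invertible s S"
    using approx star_invertible_of_approx[OF D S] by auto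
qed

section \<open>Consequences of the multiplication property\<close>

lemma PsMD_imp_star_domain:
  assumes "PsMD s"
  shows "star_domain s"
  unfolding star_domain_iff
proof (intro allI impI, elim conjE)
  fix S :: "'a fract set" assume "finite S" "\<not> S \<subseteq> {0}"
  then obtain T where T: "S * T \<subseteq> D_ring" "1 \<in> star_closure s (S * T)"
    using assms unfolding PsMD_iff star_invertible_def by metis
  then have "star_closure s (S * T) \<subseteq> star_closure s (S * inv_submodule (Dmod.span S))"
    by (intro star_closure_mono set_times_mono2) (simp_all add: subset_inv_submodule_iff)
  then show "1 \<in> star_closure s (S * inv_submodule (Dmod.span S))"
    using T(2) by auto
qed

text \<open>
  If \<open>(E + F) G\<close> approximates \<open>D\<close>, then \<open>J = E F G\<close> approximates \<open>E \<inter> F\<close>, because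
  \<open>(E \<inter> F) (E + F) \<subseteq> E F\<close>.
\<close>

lemma PsMD_imp_approx_Int:
  assumes P: "PsMD s" and E: "E \<in> fg_submodules" and F: "F \<in> fg_submodules"
  obtains J Q where "J \<in> fg_submodules" "J \<subseteq> E \<inter> F" "s E \<inter> s F \<subseteq> s J"
    "finite Q" "Q \<subseteq> D_ring" "1 \<in> star_closure s Q" "Q * (E \<inter> F) \<subseteq> J"
proof -
  obtain A where A: "finite A" "\<not> A \<subseteq> {0}" "E = Dmod.span A"
    using E unfolding fg_submodules_iff by auto
  obtain B where B: "finite B" "\<not> B \<subseteq> {0}" "F = Dmod.span B"
    using F unfolding fg_submodules_iff by auto
  have "finite (A \<union> B)" "\<not> A \<union> B \<subseteq> {0}"
    using A B by auto
  then have "star_invertible s (A \<union> B)"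
    using P unfolding PsMD_iff by metis
  then obtain T where T: "finite T" "(A \<union> B) * T \<subseteq> D_ring" "1 \<in> star_closure s ((A \<union> B) * T)"
    unfolding star_invertible_def by auto
  \<comment> \<open>These products generate \<open>E F G\<close>, where \<open>T\<close> generates
    \<open>G\<close>. Since \<open>A * T\<close> and \<open>B * T\<close> lie in
    \<open>D_ring\<close>, the products lie in both \<open>E\<close> and \<open>F\<close>.\<close>
  let ?U = "A * T * B"
  have U: "finite ?U" "\<not> ?U \<subseteq> {0}"
    using A B T(1) star_invertible_nonzero[OF T(3)]
    by (simp_all add: finite_set_times subset_zero_times_iff)
  have U': "?U = B * T * A"
    by (simp only: mult.assoc mult.commute mult.left_commute)
  have D: "h * t \<in> D_ring" if "h \<in> A \<union> B" "t \<in> T" for h t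
    using T(2) set_times_intro[OF that] by auto
  show thesis
  proof (rule that[of "Dmod.span ?U" "(A \<union> B) * T"])
    show "Dmod.span ?U \<in> fg_submodules"
      unfolding fg_submodules_iff using U by metis
    have "x * t * y \<in> Dmod.span C" if "x \<in> A \<union> B" "t \<in> T" "y \<in> C" for x t y C
      using subspace_mult[OF Dmod.subspace_span D[OF that(1,2)] Dmod.span_base[OF that(3)]] .
    then have "B * T * A \<subseteq> E" "A * T * B \<subseteq> F"
      unfolding A(3) B(3) by (auto elim!: set_times_elim)
    then have "?U \<subseteq> E" "?U \<subseteq> F"
      unfolding U'[symmetric] by auto
    then show "Dmod.span ?U \<subseteq> E \<inter> F"
      unfolding A(3) B(3) by (intro Int_greatest Dmod.span_minimal Dmod.subspace_span)
    show "s E \<inter> s F \<subseteq> s (Dmod.span ?U)"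
    proof
      fix x assume "x \<in> s E \<inter> s F"
      then have x: "x \<in> star_closure s A" "x \<in> star_closure s B"
        unfolding A(3) B(3) star_span[OF A(2)] star_span[OF B(2)] by auto
      have *: "z * x \<in> star_closure s (C * T * C')"
        if "z \<in> C * T" "x \<in> star_closure s C'" for z C C'
        using subset_star_closure[of "C * T"] star_closure_times[of "C * T" C'] that
          set_times_intro[of z "star_closure s (C * T)" x] by auto
      \<comment> \<open>Factors from \<open>A * T\<close> meet \<open>x\<close> as an element of the
        closure of \<open>B\<close>, factors from \<open>B * T\<close> meet it in the closure of
        \<open>A\<close>.\<close>
      have "1 * x \<in> star_closure s ?U"
      proof (rule star_closure_times_left[OF T(3)])
        fix z assume "z \<in> (A \<union> B) * T"
        then have "z \<in> A * T \<or> z \<in> B * T"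
          by (auto elim!: set_times_elim)
        then show "z * x \<in> star_closure s ?U"
          using *[of z A B] *[of z B A] x unfolding U'[symmetric] by auto
      qed
      then show "x \<in> s (Dmod.span ?U)"
        unfolding star_span[OF U(2)] by simp
    qed
    show "finite ((A \<union> B) * T)"
      using A B T(1) by (simp add: finite_set_times)
    have *: "(C * T) * Dmod.span C' \<subseteq> Dmod.span (C * T * C')" for C C'
    proof -
      have "(C * T) * Dmod.span C' \<subseteq> Dmod.span (C * T) * Dmod.span C'"
        by (intro set_times_mono2 Dmod.span_superset subset_refl)
      also have "\<dots> \<subseteq> Dmod.span (C * T * C')"
        by (intro span_times_span_subset Dmod.subspace_span Dmod.span_superset)
      finally show ?thesis .
    qed
    \<comment> \<open>The same exchange without closures: \<open>A * T\<close> acts on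
      \<open>F\<close> and \<open>B * T\<close> on \<open>E\<close>.\<close>
    show "(A \<union> B) * T * (E \<inter> F) \<subseteq> Dmod.span ?U"
    proof
      fix z assume "z \<in> (A \<union> B) * T * (E \<inter> F)"
      then have "z \<in> A * T * F \<or> z \<in> B * T * E"
        by (fastforce elim!: set_times_elim intro!: set_times_intro)
      then show "z \<in> Dmod.span ?U"
        using *[of A B] *[of B A] unfolding A(3) B(3) U'[symmetric] by auto
    qed
  qed (use T in auto)
qed

text \<open>The invertibility witness \<open>T\<close> generates \<open>G\<close>, and
  \<open>Q = S * T\<close> works by regrouping: an element of \<open>S\<close> times one of the
  inverse lies in \<open>D_ring\<close> and acts on \<open>T\<close>.\<close>

lemma PsMD_imp_approx_inv:
  assumes P: "PsMD s" and F: "F \<in> fg_submodules"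
  obtains G Q where "G \<in> fg_submodules" "G \<subseteq> inv_submodule F"
    "finite Q" "Q \<subseteq> D_ring" "1 \<in> star_closure s Q" "Q * inv_submodule F \<subseteq> G"
proof -
  obtain S where S: "finite S" "\<not> S \<subseteq> {0}" "F = Dmod.span S"
    using F unfolding fg_submodules_iff by auto
  then obtain T where T: "finite T" "S * T \<subseteq> D_ring" "1 \<in> star_closure s (S * T)"
    using P unfolding PsMD_iff star_invertible_def by metis
  show thesis
  proof (rule that[of "Dmod.span T" "S * T"])
    show "Dmod.span T \<in> fg_submodules"
      unfolding fg_submodules_iff using T(1) star_invertible_nonzero[OF T(3)] by metis
    show "Dmod.span T \<subseteq> inv_submodule F"
      unfolding S(3) using T(2) subset_inv_submodule_iff subspace_inv_submodule
      by (intro Dmod.span_minimal) auto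
    have "(x * y) * t \<in> Dmod.span T" if "x \<in> S" "t \<in> T" "y \<in> inv_submodule F" for x y t
    proof (rule subspace_mult[OF Dmod.subspace_span _ Dmod.span_base[OF that(2)]])
      show "x * y \<in> D_ring"
        using times_inv_submodule_subset[of S] set_times_intro[OF that(1,3)] unfolding S(3) by auto
    qed
    then show "S * T * inv_submodule F \<subseteq> Dmod.span T"
      by (auto elim!: set_times_elim simp: mult_ac)
  qed (use S T in \<open>auto intro: finite_set_times\<close>)
qed

section \<open>The individual equivalences\<close>

lemma PsMD_iff_extracoherent: "PsMD s \<longleftrightarrow> extracoherent s \<and> star_domain s"
proof (intro iffI conjI)
  assume P: "PsMD s"
  show "star_domain s"
    using P by (rule PsMD_imp_star_domain)
  show "extracoherent s"
    unfolding extracoherent_def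
  proof (intro ballI impI)
    fix E F :: "'a fract set" assume EF: "E \<in> fg_submodules" "F \<in> fg_submodules"
    obtain J where J: "J \<in> fg_submodules" "J \<subseteq> E \<inter> F" "s E \<inter> s F \<subseteq> s J"
      using PsMD_imp_approx_Int[OF P EF] .
    have "s J \<subseteq> s E" "s J \<subseteq> s F"
      using J(1,2) EF by (simp_all add: star_mono fg_in_nonzero_submodules)
    then show "\<exists>J\<in>fg_submodules. J \<subseteq> E \<inter> F \<and> s J = s E \<inter> s F"
      using J by auto
  qed
next
  assume *: "extracoherent s \<and> star_domain s"
  show "PsMD s"
  proof (rule PsMD_of_approx_Int)
    fix E F :: "'a fract set"
    assume EF: "E \<in> fg_submodules" "F \<in> fg_submodules" "E \<inter> F \<in> nonzero_submodules"
    then have "E \<inter> F \<noteq> {0}"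
      by (simp add: nonzero_submodules_def)
    then obtain J where J: "J \<in> fg_submodules" "J \<subseteq> E \<inter> F" "s J = s E \<inter> s F"
      using * EF unfolding extracoherent_def by metis
    have "J \<subseteq> star_f s (E \<inter> F)"
      using J(2) star_f_extensive[OF EF(3)] by (rule order_trans)
    moreover have "E \<inter> F \<subseteq> s J"
      unfolding J(3) using EF(1,2)[THEN fg_in_nonzero_submodules, THEN star_extensive] by auto
    ultimately show "\<exists>J\<in>fg_submodules. J \<subseteq> star_f s (E \<inter> F) \<and> E \<inter> F \<subseteq> s J"
      using J(1) by auto
  qed (use * in auto)
qed

lemma extracoherent_star_f_iff: "extracoherent (star_f s) \<longleftrightarrow> extracoherent s"
  unfolding extracoherent_def by (auto simp: star_f_fg)

text \<open>The witness \<open>Q\<close> gives \<open>J\<close> the same stable closure as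
  \<open>E \<inter> F\<close>; stability under intersections then lets one \<open>J\<close> serve
  both extracoherence and true coherence.\<close>

lemma PsMD_imp_tilde_Int:
  assumes P: "PsMD s" and E: "E \<in> fg_submodules" and F: "F \<in> fg_submodules"
    and EF: "E \<inter> F \<noteq> {0}"
  obtains J where "J \<in> fg_submodules" "J \<subseteq> E \<inter> F" "star_tilde s J = star_tilde s (E \<inter> F)"
    "star_tilde s J = star_tilde s E \<inter> star_tilde s F"
proof -
  note ns = fg_in_nonzero_submodules
  have EF': "E \<inter> F \<in> nonzero_submodules"
    using E F EF by (simp add: Int_in_nonzero_submodules_iff ns)
  obtain J Q where J: "J \<in> fg_submodules" "J \<subseteq> E \<inter> F"
    and Q: "finite Q" "Q \<subseteq> D_ring" "1 \<in> star_closure s Q" "Q * (E \<inter> F) \<subseteq> J"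
    using PsMD_imp_approx_Int[OF P E F] .
  have "star_tilde s J = star_tilde s (E \<inter> F)"
    using star_tilde_mono[OF ns[OF J(1)] EF' J(2)]
      star_tilde_subset_of_times[OF ns[OF J(1)] EF' Q] by (rule subset_antisym)
  moreover have "star_tilde s (E \<inter> F) = star_tilde s E \<inter> star_tilde s F"
    using ns[OF E] ns[OF F] EF' by (rule star_tilde_Int)
  ultimately show thesis
    using that J by simp
qed

text \<open>Equal stable closures give both bounds of \<open>PsMD_of_approx_Int\<close>, because
  \<open>star_tilde s\<close> lies below \<open>star_f s\<close>, which lies below
  \<open>s\<close>.\<close>

lemma PsMD_of_tilde_Int:
  assumes D: "star_domain s"
    and tilde: "\<And>E F. \<lbrakk>E \<in> fg_submodules; F \<in> fg_submodules; E \<inter> F \<noteq> {0}\<rbrakk> \<Longrightarrow>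
      \<exists>J\<in>fg_submodules. star_tilde s J = star_tilde s (E \<inter> F)"
  shows "PsMD s"
proof (rule PsMD_of_approx_Int[OF D])
  fix E F :: "'a fract set"
  assume EF: "E \<in> fg_submodules" "F \<in> fg_submodules" "E \<inter> F \<in> nonzero_submodules"
  then have "E \<inter> F \<noteq> {0}"
    by (simp add: nonzero_submodules_def)
  then obtain J where J: "J \<in> fg_submodules" "star_tilde s J = star_tilde s (E \<inter> F)"
    using tilde EF by metis
  note ns = fg_in_nonzero_submodules[OF J(1)]
  have "J \<subseteq> star_f s (E \<inter> F)"
    using star_tilde_extensive[OF ns] star_tilde_subset_star_f[OF EF(3)] unfolding J(2)
    by (rule order_trans)
  moreover have "E \<inter> F \<subseteq> s J"
    using star_tilde_extensive[OF EF(3)] star_tilde_subset_star_f[OF ns] star_f_subset[OF ns]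
    unfolding J(2) by auto
  ultimately show "\<exists>J\<in>fg_submodules. J \<subseteq> star_f s (E \<inter> F) \<and> E \<inter> F \<subseteq> s J"
    using J(1) by auto
qed

lemma coherent_star_tilde_iff: "coherent (star_tilde s) \<longleftrightarrow> truly_coherent (star_tilde s)"
proof -
  have "star_tilde s (E \<inter> F) = star_tilde s E \<inter> star_tilde s F"
    if "E \<in> fg_submodules" "F \<in> fg_submodules" "E \<inter> F \<noteq> {0}" for E F
    using that by (intro star_tilde_Int)
      (simp_all add: Int_in_nonzero_submodules_iff fg_in_nonzero_submodules)
  then show ?thesis
    unfolding coherent_def truly_coherent_def by simp
qed

lemma PsMD_iff_extracoherent_star_tilde: "PsMD s \<longleftrightarrow> extracoherent (star_tilde s) \<and> star_domain s"
  and PsMD_iff_truly_coherent_star_tilde: "PsMD s \<longleftrightarrow> truly_coherent (star_tilde s) \<and> star_domain s"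
proof -
  \<comment> \<open>The implications form a cycle through extracoherence and true coherence, closed
    with the help of the domain condition.\<close>
  have 1: "extracoherent (star_tilde s)" if P: "PsMD s"
    unfolding extracoherent_def using PsMD_imp_tilde_Int[OF P] by metis
  have 2: "truly_coherent (star_tilde s)" if "extracoherent (star_tilde s)"
    using extracoherent_imp_coherent[OF that] by (simp add: coherent_star_tilde_iff)
  have 3: "PsMD s" if "truly_coherent (star_tilde s)" "star_domain s"
    using PsMD_of_tilde_Int[OF that(2)] that(1) unfolding truly_coherent_def by metis
  show "PsMD s \<longleftrightarrow> extracoherent (star_tilde s) \<and> star_domain s"
    "PsMD s \<longleftrightarrow> truly_coherent (star_tilde s) \<and> star_domain s"
    using 1 2 3 PsMD_imp_star_domain by metis+
qed

text \<open>Transfers conditions from the stable operation to the finite type one: each module lies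
  in the stable closure of the other, hence in its finite type closure.\<close>

lemma star_f_eq_of_tilde_eq:
  assumes E: "E \<in> nonzero_submodules" and F: "F \<in> nonzero_submodules"
    and EF: "star_tilde s E = star_tilde s F"
  shows "star_f s E = star_f s F"
proof (rule subset_antisym)
  have "E \<subseteq> star_f s F"
    using star_tilde_extensive[OF E] star_tilde_subset_star_f[OF F] unfolding EF by (rule order_trans)
  then show "star_f s E \<subseteq> star_f s F"
    by (rule star_f_least[OF F E])
  have "F \<subseteq> star_f s E"
    using star_tilde_extensive[OF F] star_tilde_subset_star_f[OF E] unfolding EF by (rule order_trans)
  then show "star_f s F \<subseteq> star_f s E"
    by (rule star_f_least[OF E F])
qed

lemma PsMD_iff_truly_coherent_star_f: "PsMD s \<longleftrightarrow> truly_coherent (star_f s) \<and> star_domain s"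
proof (intro iffI conjI)
  assume P: "PsMD s"
  show "star_domain s"
    using P by (rule PsMD_imp_star_domain)
  show "truly_coherent (star_f s)"
    unfolding truly_coherent_def
  proof (intro ballI impI)
    fix E F :: "'a fract set" assume EF: "E \<in> fg_submodules" "F \<in> fg_submodules" "E \<inter> F \<noteq> {0}"
    then obtain J where J: "J \<in> fg_submodules" "star_tilde s J = star_tilde s (E \<inter> F)"
      using PsMD_imp_tilde_Int[OF P] by metis
    have "star_f s J = star_f s (E \<inter> F)"
      using EF J(1)
      by (intro star_f_eq_of_tilde_eq[OF _ _ J(2)])
        (simp_all add: Int_in_nonzero_submodules_iff fg_in_nonzero_submodules)
    then show "\<exists>J\<in>fg_submodules. star_f s J = star_f s (E \<inter> F)"
      using J(1) by auto
  qed
next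
  assume *: "truly_coherent (star_f s) \<and> star_domain s"
  show "PsMD s"
  proof (rule PsMD_of_approx_Int)
    fix E F :: "'a fract set"
    assume EF: "E \<in> fg_submodules" "F \<in> fg_submodules" "E \<inter> F \<in> nonzero_submodules"
    then have "E \<inter> F \<noteq> {0}"
      by (simp add: nonzero_submodules_def)
    then obtain J where J: "J \<in> fg_submodules" "star_f s J = star_f s (E \<inter> F)"
      using * EF unfolding truly_coherent_def by metis
    have "J \<subseteq> star_f s (E \<inter> F)" "E \<inter> F \<subseteq> s J"
      using star_f_extensive[OF fg_in_nonzero_submodules[OF J(1)]] star_f_extensive[OF EF(3)]
      unfolding J(2)[symmetric] star_f_fg[OF J(1)] by auto
    then show "\<exists>J\<in>fg_submodules. J \<subseteq> star_f s (E \<inter> F) \<and> E \<inter> F \<subseteq> s J"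
      using J(1) by auto
  qed (use * in auto)
qed

lemma quasi_coherent_star_f_of_star_tilde:
  assumes "quasi_coherent (star_tilde s)"
  shows "quasi_coherent (star_f s)"
  unfolding quasi_coherent_def
proof
  fix F :: "'a fract set" assume F: "F \<in> fg_submodules"
  then obtain G where G: "G \<in> fg_submodules" "star_tilde s (inv_submodule F) = star_tilde s G"
    using assms unfolding quasi_coherent_def by metis
  then show "\<exists>G\<in>fg_submodules. star_f s (inv_submodule F) = star_f s G"
    using star_f_eq_of_tilde_eq[OF inv_submodule_fg_in_nonzero_submodules[OF F]
        fg_in_nonzero_submodules[OF G(1)] G(2)] by auto
qed

text \<open>For the identity the inverse is itself finitely generated, and equal modules have equal
  closures.\<close>

lemma quasi_coherent_star_f_of_id:
  assumes "quasi_coherent (id :: 'a fract set \<Rightarrow> 'a fract set)"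
  shows "quasi_coherent (star_f s)"
  using assms unfolding quasi_coherent_def id_def by metis

lemma PsMD_iff_quasi_coherent_star_f: "PsMD s \<longleftrightarrow> quasi_coherent (star_f s) \<and> star_domain s"
  and PsMD_iff_quasi_coherent_star_tilde: "PsMD s \<longleftrightarrow> quasi_coherent (star_tilde s) \<and> star_domain s"
proof -
  \<comment> \<open>Again a cycle: the stable version implies the finite type version, which returns
    to \<open>PsMD s\<close> in a \<star>-domain.\<close>
  have 1: "quasi_coherent (star_tilde s)" if P: "PsMD s"
    unfolding quasi_coherent_def
  proof
    fix F :: "'a fract set" assume F: "F \<in> fg_submodules"
    obtain G Q where G: "G \<in> fg_submodules" "G \<subseteq> inv_submodule F"
      and Q: "finite Q" "Q \<subseteq> D_ring" "1 \<in> star_closure s Q" "Q * inv_submodule F \<subseteq> G"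
      using PsMD_imp_approx_inv[OF P F] .
    note ns = fg_in_nonzero_submodules[OF G(1)] inv_submodule_fg_in_nonzero_submodules[OF F]
    have "star_tilde s (inv_submodule F) = star_tilde s G"
      using star_tilde_subset_of_times[OF ns Q] star_tilde_mono[OF ns G(2)]
      by (rule subset_antisym)
    then show "\<exists>G\<in>fg_submodules. star_tilde s (inv_submodule F) = star_tilde s G"
      using G(1) by auto
  qed
  have 2: "PsMD s" if qc: "quasi_coherent (star_f s)" and D: "star_domain s"
  proof (rule PsMD_of_approx_inv[OF D])
    fix F :: "'a fract set" assume F: "F \<in> fg_submodules"
    obtain G where G: "G \<in> fg_submodules" "star_f s (inv_submodule F) = star_f s G"
      using qc F unfolding quasi_coherent_def by metis
    have "G \<subseteq> star_f s (inv_submodule F)"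
      unfolding G(2) using G(1) by (intro star_f_extensive fg_in_nonzero_submodules)
    moreover have "inv_submodule F \<subseteq> s G"
      using star_f_extensive[OF inv_submodule_fg_in_nonzero_submodules[OF F]]
      unfolding G(2) star_f_fg[OF G(1)] .
    ultimately show "\<exists>G\<in>fg_submodules. G \<subseteq> star_f s (inv_submodule F) \<and> inv_submodule F \<subseteq> s G"
      using G(1) by auto
  qed
  show "PsMD s \<longleftrightarrow> quasi_coherent (star_f s) \<and> star_domain s"
    "PsMD s \<longleftrightarrow> quasi_coherent (star_tilde s) \<and> star_domain s"
    using 1 2 quasi_coherent_star_f_of_star_tilde PsMD_imp_star_domain by metis+
qed

end

theorem theorem2:
  fixes s :: "'a::idom fract set \<Rightarrow> 'a fract set"
  assumes "semistar s"
  shows "(PsMD s \<longleftrightarrow> extracoherent s \<and> star_domain s) \<and>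
         (PsMD s \<longleftrightarrow> extracoherent (star_f s) \<and> star_domain s) \<and>
         (PsMD s \<longleftrightarrow> extracoherent (star_tilde s) \<and> star_domain s) \<and>
         (PsMD s \<longleftrightarrow> truly_coherent (star_f s) \<and> star_domain s) \<and>
         (PsMD s \<longleftrightarrow> truly_coherent (star_tilde s) \<and> star_domain s) \<and>
         (PsMD s \<longleftrightarrow> coherent (star_tilde s) \<and> star_domain s) \<and>
         (PsMD s \<longleftrightarrow> quasi_coherent (star_f s) \<and> star_domain s) \<and>
         (PsMD s \<longleftrightarrow> quasi_coherent (star_f s) \<and> star_domain (star_f s)) \<and>
         (PsMD s \<longleftrightarrow> star_domain (star_f s)) \<and>
         (PsMD s \<longleftrightarrow> quasi_coherent (star_tilde s) \<and> star_domain s) \<and>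
         (PsMD s \<longleftrightarrow> quasi_coherent (star_tilde s) \<and> star_domain (star_tilde s)) \<and>
         (PsMD s \<longleftrightarrow> star_domain (star_tilde s)) \<and>
         (quasi_coherent (id :: 'a fract set \<Rightarrow> 'a fract set) \<and> star_domain s \<longrightarrow> PsMD s)"
proof -
  interpret semistar_operation s
    using assms by unfold_locales
  \<comment> \<open>All three conditions unfold to invertibility of every nonzero finitely generated
    module; this also settles the variants that pair quasi-coherence with these domain
    conditions.\<close>
  have f: "PsMD s \<longleftrightarrow> star_domain (star_f s)" and tilde: "PsMD s \<longleftrightarrow> star_domain (star_tilde s)"
    by (simp_all add: PsMD_iff star_domain_star_f_iff star_domain_star_tilde_iff)
  show ?thesis
    using PsMD_iff_extracoherent extracoherent_star_f_iff PsMD_iff_extracoherent_star_tilde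
      PsMD_iff_truly_coherent_star_f PsMD_iff_truly_coherent_star_tilde coherent_star_tilde_iff
      PsMD_iff_quasi_coherent_star_f PsMD_iff_quasi_coherent_star_tilde
      quasi_coherent_star_f_of_id f tilde
    by (intro conjI) metis+
qed

end
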